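(* Let $\mathcal Z$ be finite with every subset measurable, let $\Gamma_\theta$, $L_\theta$, $\overline{\mathcal M}_\theta$ ($\theta\in\Theta$) be as in the context, with $\Gamma_\theta\neq\varnothing$ for every $\theta\in\Theta$, and let $Z_1,\dots,Z_n$ be i.i.d. from $\mu^*\in\mathbf P$, where $\mathbf P$ is a collection of probability measures on $\mathcal Z$. Let $(\lambda_n)$ be positive numbers with $\lambda_n\to\infty$ and $\lambda_n=o(\sqrt n)$. Let $\alpha\in(0,1)$ and $\varepsilon>0$ be fixed, and let $\hat c_{1-\alpha}(\theta)$ denote the $1-\alpha$ quantile of the bootstrap distribution (conditional distribution given $Z_1,\dots,Z_n$) of $$\sup_{\phi\in\Phi}\bigl(\mathbb G^*_{n,\mu^*}(\phi)+\lambda_n\eta_{\theta,n}(\phi)\bigr)-\lambda_nT_n(\theta).$$ Then $$\liminf_{n\to\infty}\ \inf_{\mu^*\in\mathbf P,\ \theta\in\Theta_I(\mu^* )}\ \mathbb P_{\mu^*}\bigl(\sqrt n\,T_n(\theta)\le\hat c_{1-\alpha}(\theta)+\varepsilon\bigr)\ \ge\ 1-\alpha .$$ Moreover, with $\Theta_n^\Delta(\mu^* )=\{\theta\in\Theta:T_{\mu^*}(\theta)\ge\Delta/\sqrt n\}$ for $\Delta>0$, $$\limsup_{\Delta\to\infty}\ \limsup_{n\to\infty}\ \sup_{\mu^*\in\mathbf P,\ \theta\in\Theta_n^\Delta(\mu^* )}\ \mathbb P_{\mu^*}\bigl(\sqrt n\,T_n(\theta)\le\hat c_{1-\alpha}(\theta)+\varepsilon\bigr)=0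 .$$ (For probabilities, an infimum over an empty index set is read as $1$ and a supremum over an empty index set as $0$.)
   Context: Model. $\mathcal Y,\mathcal X,\mathcal U$ are measurable spaces, $\mathcal W=\mathcal X\times\mathcal U$, $\mathcal Z=\mathcal Y\times\mathcal X$. For each $\theta\in\Theta$, $\Gamma_\theta$ is the set of probability measures $\gamma$ on $\mathcal W$ with $\mathbb E_\gamma[g_{1,j}(W;\theta)]=0$ for all $j\in\mathcal J$ and $\mathbb E_\gamma[g_{2,k}(W;\theta)]\le 0$ for all $k\in\mathcal K$, for arbitrary index sets $\mathcal J,\mathcal K$ and real measurable functions $g_{1,j},g_{2,k}$ on $\mathcal W$ (assumed $\gamma$-integrable for $\gamma\in\Gamma_\theta$). $K_\theta$ is a probability kernel from $\mathcal W$ to $\mathcal Z$ whose $\mathcal X$-marginal at $(x,u)$ is $\delta_x$, and $(L_\theta\gamma)(B)=\int K_\theta(B\mid w)\,d\gamma(w)$. $\overline{\mathcal M}_\theta$ is the closure of $\{L_\theta\gamma:\gamma\in\Gamma_\theta\}$ in total variation within the probability measures on $\mathcal Z$. The identified set is $\Theta_I(\mu^* )=\{\theta\in\Theta:\mu^*\in\overline{\mathcal M}_\theta\}$. Notation. $\Phi=[0,1]^{\mathcal Z}$; $\mathbb E_n[\phi]=n^{-1}\sum_{i=1}^n\phi(Z_i)$; $$\eta_{\theta,\mu^*}(\phi)=\inf_{\mu\in\overline{\mathcal M}_\theta}(\mathbb E_{\mu^*}[\phi]-\mathbb E_\mu[\phi]),\qquad \eta_{\theta,n}(\phi)=\inf_{\mu\in\overline{\mathcal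 M}_\theta}(\mathbb E_n[\phi]-\mathbb E_\mu[\phi]),$$ $T_{\mu^*}(\theta)=\sup_{\phi\in\Phi}\eta_{\theta,\mu^*}(\phi)$, $T_n(\theta)=\sup_{\phi\in\Phi}\eta_{\theta,n}(\phi)$. Bootstrap. Given the data, $Z_1^*,\dots,Z_n^*$ are drawn with replacement (i.i.d. uniformly) from $\{Z_1,\dots,Z_n\}$, and $\mathbb G^*_{n,\mu^*}(\phi)=\sqrt n\bigl(n^{-1}\sum_{i=1}^n\phi(Z_i^* )-\mathbb E_n[\phi]\bigr)$. The $q$-quantile of a distribution function $F$ is $\inf\{t:F(t)\ge q\}$. $\mathbb P_{\mu^*}$ is probability when the data are i.i.d. from $\mu^*$. *)

theory Defs
  imports "HOL-Probability.Probability" "HOL-Library.Landau_Symbols"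
begin

(* Integrability is part of the moment conditions: the Bochner integral of a
   non-integrable function is 0 by convention and would satisfy them vacuously. *)
definition moment_measures ::
  "'w measure \<Rightarrow> 'j set \<Rightarrow> 'k set \<Rightarrow> ('j \<Rightarrow> 'w \<Rightarrow> real) \<Rightarrow> ('k \<Rightarrow> 'w \<Rightarrow> real) \<Rightarrow> 'w measure set" where
  "moment_measures W J K g1 g2 =
     {\<gamma> \<in> space (prob_algebra W).
        (\<forall>j\<in>J. integrable \<gamma> (g1 j) \<and> (\<integral>w. g1 j w \<partial>\<gamma>) = 0) \<and>
        (\<forall>k\<in>K. integrable \<gamma> (g2 k) \<and> (\<integral>w. g2 k w \<partial>\<gamma>) \<le> 0)}"

definition tv_dist :: "'z measure \<Rightarrow> 'z measure \<Rightarrow> 'z measure \<Rightarrow> real" where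
  "tv_dist Z \<mu> \<nu> = (SUP B\<in>sets Z. \<bar>measure \<mu> B - measure \<nu> B\<bar>)"

definition tv_closure :: "'z measure \<Rightarrow> 'z measure set \<Rightarrow> 'z measure set" where
  "tv_closure Z S = {\<mu> \<in> space (prob_algebra Z). \<forall>e>0. \<exists>\<nu>\<in>S. tv_dist Z \<mu> \<nu> < e}"

definition identified_set :: "'p set \<Rightarrow> ('p \<Rightarrow> 'z measure set) \<Rightarrow> 'z measure \<Rightarrow> 'p set" where
  "identified_set \<Theta> Mbar \<mu> = {\<theta> \<in> \<Theta>. \<mu> \<in> Mbar \<theta>}"

definition test_functions :: "'z measure \<Rightarrow> ('z \<Rightarrow> real) set" where
  "test_functions Z = (space Z \<rightarrow>\<^sub>E {0..1})"

(* A sample of size n consists of z 0, ..., z (n - 1). *)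
definition emp_mean :: "nat \<Rightarrow> (nat \<Rightarrow> 'z) \<Rightarrow> ('z \<Rightarrow> real) \<Rightarrow> real" where
  "emp_mean n z \<phi> = (\<Sum>i<n. \<phi> (z i)) / real n"

(* The argument E is an expectation functional: integral\<^sup>L \<mu> gives the population
   version, emp_mean n z the sample version; similarly for T_stat. *)
definition eta :: "'z measure set \<Rightarrow> (('z \<Rightarrow> real) \<Rightarrow> real) \<Rightarrow> ('z \<Rightarrow> real) \<Rightarrow> real" where
  "eta M E \<phi> = (INF \<mu>\<in>M. E \<phi> - (\<integral>z. \<phi> z \<partial>\<mu>))"

definition T_stat :: "'z measure \<Rightarrow> 'z measure set \<Rightarrow> (('z \<Rightarrow> real) \<Rightarrow> real) \<Rightarrow> real" where
  "T_stat Z M E = (SUP \<phi>\<in>test_functions Z. eta M E \<phi>)"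

definition alternatives ::
  "'z measure \<Rightarrow> 'p set \<Rightarrow> ('p \<Rightarrow> 'z measure set) \<Rightarrow> nat \<Rightarrow> real \<Rightarrow> 'z measure \<Rightarrow> 'p set" where
  "alternatives Z \<Theta> Mbar n \<Delta> \<mu> =
     {\<theta> \<in> \<Theta>. T_stat Z (Mbar \<theta>) (integral\<^sup>L \<mu>) \<ge> \<Delta> / sqrt (real n)}"

(* Drawing indices uniformly counts repeated values among the z i with multiplicity. *)
definition resample_pmf :: "nat \<Rightarrow> (nat \<Rightarrow> 'z) \<Rightarrow> (nat \<Rightarrow> 'z) pmf" where
  "resample_pmf n z = Pi_pmf {..<n} undefined (\<lambda>_. map_pmf z (pmf_of_set {..<n}))"

definition boot_process :: "nat \<Rightarrow> (nat \<Rightarrow> 'z) \<Rightarrow> (nat \<Rightarrow> 'z) \<Rightarrow> ('z \<Rightarrow> real) \<Rightarrow> real" where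
  "boot_process n z z' \<phi> = sqrt (real n) * (emp_mean n z' \<phi> - emp_mean n z \<phi>)"

definition boot_stat ::
  "'z measure \<Rightarrow> 'z measure set \<Rightarrow> real \<Rightarrow> nat \<Rightarrow> (nat \<Rightarrow> 'z) \<Rightarrow> (nat \<Rightarrow> 'z) \<Rightarrow> real" where
  "boot_stat Z M l n z z' =
     (SUP \<phi>\<in>test_functions Z. boot_process n z z' \<phi> + l * eta M (emp_mean n z) \<phi>)
       - l * T_stat Z M (emp_mean n z)"

definition quantile :: "(real \<Rightarrow> real) \<Rightarrow> real \<Rightarrow> real" where
  "quantile F q = Inf {t. F t \<ge> q}"

definition boot_quantile ::
  "'z measure \<Rightarrow> 'z measure set \<Rightarrow> real \<Rightarrow> nat \<Rightarrow> (nat \<Rightarrow> 'z) \<Rightarrow> real \<Rightarrow> real" where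
  "boot_quantile Z M l n z q =
     quantile (cdf (measure_pmf (map_pmf (boot_stat Z M l n z) (resample_pmf n z)))) q"

(* The n-fold product of \<mu> is the law of an i.i.d. sample of size n. *)
definition accept_prob ::
  "'z measure \<Rightarrow> 'z measure set \<Rightarrow> real \<Rightarrow> real \<Rightarrow> real \<Rightarrow> nat \<Rightarrow> 'z measure \<Rightarrow> real" where
  "accept_prob Z M l \<alpha> \<epsilon> n \<mu> =
     measure (Pi\<^sub>M {..<n} (\<lambda>_. \<mu>))
       {z \<in> space (Pi\<^sub>M {..<n} (\<lambda>_. \<mu>)).
          sqrt (real n) * T_stat Z M (emp_mean n z) \<le> boot_quantile Z M l n z (1 - \<alpha>) + \<epsilon>}"

definition inf_prob :: "'a set \<Rightarrow> ('a \<Rightarrow> real) \<Rightarrow> real" where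
  "inf_prob S p = (if S = {} then 1 else (INF s\<in>S. p s))"

definition sup_prob :: "'a set \<Rightarrow> ('a \<Rightarrow> real) \<Rightarrow> real" where
  "sup_prob S p = (if S = {} then 0 else (SUP s\<in>S. p s))"

end

theory Submission
  imports Defs "HOL-Real_Asymp.Real_Asymp"
begin

text \<open>On a finite sample space every statistic involved is a supremum over test functions of a
  linear functional of the vector of sample frequencies plus a fixed function of the test function,
  hence 1-Lipschitz in the \<open>l\<^sub>1\<close> norm of that vector, whatever the model is.

  Size. Under the null, \<open>sqrt n * T_n\<close> is dominated by the pivot, the supremum of the empirical
  process plus \<open>l\<close> times the population \<open>eta\<close>, as soon as \<open>l \<le> sqrt n\<close>. The bootstrap statistic
  is the same functional of the bootstrap process up to an error \<open>2 * l * D\<close>, where \<open>D = O(1 / sqrt n)\<close>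
  is the \<open>l\<^sub>1\<close> distance of the sample frequencies from the population. The two processes are close
  in distribution by a coupling of multinomial samples with nearby parameters. The slack
  \<open>\<epsilon>\<close> absorbs all errors, and the bounds depend only on the cardinality of the sample space.

  Power. The bootstrap quantile is at most \<open>card (space Z) / sqrt \<alpha>\<close> by Chebyshev's inequality, while
  \<open>sqrt n * T_n\<close> is at least \<open>\<Delta>\<close> minus a stochastically bounded term.\<close>

section \<open>Couplings and second moments of finitely supported distributions\<close>

lemma pmf_exists_finite:
  assumes "finite A" "\<And>x. x \<in> A \<Longrightarrow> 0 \<le> f x" "sum f A = 1"
  obtains p where "\<And>x. pmf p x = (if x \<in> A then f x else 0)"
proof -
  let ?g = "\<lambda>x. if x \<in> A then f x else 0"
  have "(\<integral>\<^sup>+x. ennreal (?g x) \<partial>count_space UNIV) = (\<Sum>x\<in>A. ennreal (?g x))"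
    by (rule nn_integral_count_space'[OF assms(1)]) (auto simp: assms(2))
  also have "\<dots> = ennreal (\<Sum>x\<in>A. ?g x)"
    by (rule sum_ennreal) (auto simp: assms(2))
  also have "(\<Sum>x\<in>A. ?g x) = 1"
    using assms(3) by (simp cong: sum.cong)
  finally have "(\<integral>\<^sup>+x. ennreal (?g x) \<partial>count_space UNIV) = 1" by simp
  then have "pmf (embed_pmf ?g) x = ?g x" for x
    by (intro pmf_embed_pmf) (auto simp: assms(2))
  then show thesis by (rule that)
qed

lemma maximal_coupling_pmf:
  fixes p q :: "'a pmf"
  assumes S: "finite S" and p: "set_pmf p \<subseteq> S" and q: "set_pmf q \<subseteq> S"
  obtains r where "set_pmf r \<subseteq> S \<times> S" "map_pmf fst r = p" "map_pmf snd r = q"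
    "measure_pmf.prob r {x. fst x \<noteq> snd x} \<le> (\<Sum>s\<in>S. \<bar>pmf p s - pmf q s\<bar>)"
proof -
  define m where "m = (\<lambda>a. min (pmf p a) (pmf q a))"
  define s where "s = (\<Sum>a\<in>S. pmf p a - m a)"
  have sum_p: "(\<Sum>a\<in>S. pmf p a) = 1" and sum_q: "(\<Sum>a\<in>S. pmf q a) = 1"
    using sum_pmf_eq_1[OF S p] sum_pmf_eq_1[OF S q] by auto
  have m_p: "m a \<le> pmf p a" and m_q: "m a \<le> pmf q a" and m_0: "0 \<le> m a" for a
    by (auto simp: m_def)
  have s_q: "s = (\<Sum>a\<in>S. pmf q a - m a)"
    using sum_p sum_q by (simp add: s_def sum_subtractf)
  have s_0: "0 \<le> s" unfolding s_def by (intro sum_nonneg) (simp add: m_p)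
  have zero_p: "pmf p a - m a = 0" if "s = 0" "a \<in> S" for a
  proof -
    have "\<forall>x\<in>S. pmf p x - m x = 0"
      using that(1) sum_nonneg_eq_0_iff[OF S, of "\<lambda>a. pmf p a - m a"] m_p by (auto simp: s_def)
    then show ?thesis using that(2) by blast
  qed
  have zero_q: "pmf q a - m a = 0" if "s = 0" "a \<in> S" for a
  proof -
    have "\<forall>x\<in>S. pmf q x - m x = 0"
      using that(1) sum_nonneg_eq_0_iff[OF S, of "\<lambda>a. pmf q a - m a"] m_q by (auto simp: s_q)
    then show ?thesis using that(2) by blast
  qed
  define g where "g = (\<lambda>(a, b). (if a = b then m a else 0) + (pmf p a - m a) * (pmf q b - m b) / s)"
  have g_0: "0 \<le> g x" for x
    using m_p m_q m_0 s_0 by (auto simp: g_def split: prod.split intro!: add_nonneg_nonneg mult_nonneg_nonneg divide_nonneg_nonneg)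
  have g_fst: "(\<Sum>b\<in>S. g (a, b)) = pmf p a" if "a \<in> S" for a
  proof -
    have "(\<Sum>b\<in>S. g (a, b)) = m a + (pmf p a - m a) * s / s"
      using that S by (simp add: g_def sum.distrib s_q sum_divide_distrib[symmetric] sum_distrib_left[symmetric])
    then show ?thesis using zero_p[OF _ that] by (cases "s = 0") auto
  qed
  have g_snd: "(\<Sum>a\<in>S. g (a, b)) = pmf q b" if "b \<in> S" for b
  proof -
    have "(\<Sum>a\<in>S. g (a, b)) = m b + s * (pmf q b - m b) / s"
      using that S by (simp add: g_def sum.distrib s_def sum_divide_distrib[symmetric] sum_distrib_right[symmetric])
    then show ?thesis using zero_q[OF _ that] by (cases "s = 0") auto
  qed
  have "sum g (S \<times> S) = 1"
    using sum_p g_fst by (simp add: sum.cartesian_product')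
  then obtain r where r: "\<And>x. pmf r x = (if x \<in> S \<times> S then g x else 0)"
    using pmf_exists_finite[of "S \<times> S" g] S g_0 by auto
  have sub: "set_pmf r \<subseteq> S \<times> S"
    by (auto simp: set_pmf_eq r split: if_splits)
  have prob_r: "measure_pmf.prob r A = (\<Sum>x\<in>A \<inter> S \<times> S. g x)" for A
  proof -
    have "measure_pmf.prob r A = measure_pmf.prob r (A \<inter> S \<times> S)"
      by (rule measure_pmf.finite_measure_eq_AE) (use sub in \<open>auto simp: AE_measure_pmf_iff\<close>)
    then show ?thesis using S by (simp add: measure_measure_pmf_finite r)
  qed
  have "pmf (map_pmf fst r) a = pmf p a" for a
  proof -
    have "pmf (map_pmf fst r) a = (\<Sum>x\<in>fst -` {a} \<inter> S \<times> S. g x)"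
      by (simp add: pmf_map prob_r)
    also have "fst -` {a} \<inter> S \<times> S = (if a \<in> S then Pair a ` S else {})" by auto
    finally show ?thesis
      using p by (auto simp: sum.reindex inj_on_def g_fst set_pmf_iff)
  qed
  moreover have "pmf (map_pmf snd r) b = pmf q b" for b
  proof -
    have "pmf (map_pmf snd r) b = (\<Sum>x\<in>snd -` {b} \<inter> S \<times> S. g x)"
      by (simp add: pmf_map prob_r)
    also have "snd -` {b} \<inter> S \<times> S = (if b \<in> S then (\<lambda>a. (a, b)) ` S else {})" by auto
    finally show ?thesis
      using q by (auto simp: sum.reindex inj_on_def g_snd set_pmf_iff)
  qed
  moreover have "measure_pmf.prob r {x. fst x \<noteq> snd x} \<le> (\<Sum>s\<in>S. \<bar>pmf p s - pmf q s\<bar>)"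
  proof -
    have "measure_pmf.prob r {x. fst x \<noteq> snd x}
        = (\<Sum>x\<in>{x. fst x \<noteq> snd x} \<inter> S \<times> S. (pmf p (fst x) - m (fst x)) * (pmf q (snd x) - m (snd x)) / s)"
      by (auto simp: prob_r g_def intro!: sum.cong)
    also have "\<dots> \<le> (\<Sum>x\<in>S \<times> S. (pmf p (fst x) - m (fst x)) * (pmf q (snd x) - m (snd x)) / s)"
      using S m_p m_q s_0 by (intro sum_mono2) (auto intro!: mult_nonneg_nonneg divide_nonneg_nonneg)
    also have "\<dots> = s * s / s"
      by (simp add: sum.cartesian_product' sum_divide_distrib[symmetric] sum_product s_q)
         (simp add: s_q[symmetric] s_def[symmetric] sum_product[symmetric])
    also have "\<dots> = s" by simp
    also have "s \<le> (\<Sum>s\<in>S. \<bar>pmf p s - pmf q s\<bar>)"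
      unfolding s_def by (intro sum_mono) (auto simp: m_def)
    finally show ?thesis .
  qed
  ultimately show thesis
    by (intro that[OF sub]) (auto intro: pmf_eqI)
qed

lemma expectation_times_pair_pmf:
  fixes f :: "'a \<Rightarrow> real" and g :: "'b \<Rightarrow> real"
  assumes "finite (set_pmf p)" "finite (set_pmf q)"
  shows "measure_pmf.expectation (pair_pmf p q) (\<lambda>x. f (fst x) * g (snd x))
           = measure_pmf.expectation p f * measure_pmf.expectation q g"
proof -
  have "measure_pmf.expectation (pair_pmf p q) (\<lambda>x. f (fst x) * g (snd x))
      = (\<Sum>x\<in>set_pmf p \<times> set_pmf q. f (fst x) * g (snd x) * pmf (pair_pmf p q) x)"
    by (rule integral_measure_pmf_real) (use assms in auto)
  also have "\<dots> = (\<Sum>a\<in>set_pmf p. \<Sum>b\<in>set_pmf q. (f a * pmf p a) * (g b * pmf q b))"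
    by (auto simp: sum.cartesian_product pmf_pair intro!: sum.cong)
  also have "\<dots> = measure_pmf.expectation p f * measure_pmf.expectation q g"
    using assms by (simp add: sum_product[symmetric] integral_measure_pmf_real[where A = "set_pmf _"])
  finally show ?thesis .
qed

lemma expectation_square_sum_Pi_pmf:
  fixes f :: "'a \<Rightarrow> real"
  assumes "finite I" and p: "finite (set_pmf p)" and f: "measure_pmf.expectation p f = 0"
  shows "measure_pmf.expectation (Pi_pmf I d (\<lambda>_. p)) (\<lambda>x. (\<Sum>i\<in>I. f (x i))\<^sup>2)
           = card I * measure_pmf.expectation p (\<lambda>a. (f a)\<^sup>2)"
  using assms(1)
proof induction
  case (insert i I)
  let ?Q = "Pi_pmf I d (\<lambda>_. p)"
  let ?g = "\<lambda>x. \<Sum>i\<in>I. f (x i)"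
  have Q: "finite (set_pmf ?Q)"
    using insert p by (auto simp: set_Pi_pmf)
  have fin: "finite (set_pmf (pair_pmf p ?Q))" using p Q by simp
  have upd: "?g (x(i := y)) = ?g x" for x y
    using insert by (auto intro!: sum.cong)
  have "measure_pmf.expectation (Pi_pmf (insert i I) d (\<lambda>_. p)) (\<lambda>x. (\<Sum>i\<in>insert i I. f (x i))\<^sup>2)
      = measure_pmf.expectation (pair_pmf p ?Q)
          (\<lambda>x. (f (fst x))\<^sup>2 * 1 + 2 * (f (fst x) * ?g (snd x)) + 1 * (?g (snd x))\<^sup>2)"
    using insert by (simp add: Pi_pmf_insert case_prod_unfold upd[simplified] power2_sum algebra_simps)
  also have "\<dots> = measure_pmf.expectation (pair_pmf p ?Q) (\<lambda>x. (f (fst x))\<^sup>2 * 1)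
      + 2 * measure_pmf.expectation (pair_pmf p ?Q) (\<lambda>x. f (fst x) * ?g (snd x))
      + measure_pmf.expectation (pair_pmf p ?Q) (\<lambda>x. 1 * (?g (snd x))\<^sup>2)"
    by (subst Bochner_Integration.integral_add | (rule integrable_measure_pmf_finite[OF fin]) | simp)+
  also have "\<dots> = (1 + card I) * measure_pmf.expectation p (\<lambda>a. (f a)\<^sup>2)"
    using insert.IH f
    by (simp add: expectation_times_pair_pmf[OF p Q, of "\<lambda>a. (f a)\<^sup>2" "\<lambda>_. 1", simplified]
        expectation_times_pair_pmf[OF p Q, of f ?g]
        expectation_times_pair_pmf[OF p Q, of "\<lambda>_. 1" "\<lambda>x. (?g x)\<^sup>2", simplified] algebra_simps)
  finally show ?case using insert by simp
qed simp

lemma prob_l1_norm_gt_le: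
  fixes V :: "'s \<Rightarrow> 'a \<Rightarrow> real" and v :: real
  assumes R: "finite (set_pmf R)" and "\<kappa> > 0"
    and v: "\<And>s. s \<in> S \<Longrightarrow> measure_pmf.expectation R (\<lambda>x. (V s x)\<^sup>2) \<le> v"
  shows "measure_pmf.prob R {x. (\<Sum>s\<in>S. \<bar>V s x\<bar>) > \<kappa>} \<le> (card S)\<^sup>2 * v / \<kappa>\<^sup>2"
proof -
  note [simp] = integrable_measure_pmf_finite[OF R]
  have "measure_pmf.prob R {x. (\<Sum>s\<in>S. \<bar>V s x\<bar>) > \<kappa>}
      = measure_pmf.expectation R (indicator {x. (\<Sum>s\<in>S. \<bar>V s x\<bar>) > \<kappa>})" by simp
  also have "\<dots> \<le> measure_pmf.expectation R (\<lambda>x. card S / \<kappa>\<^sup>2 * (\<Sum>s\<in>S. (V s x)\<^sup>2))"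
  proof (rule integral_mono)
    fix x
    have "(\<Sum>s\<in>S. \<bar>V s x\<bar>)\<^sup>2 \<le> (\<Sum>s\<in>S. (V s x)\<^sup>2) * card S"
      using sum_squared_le_sum_of_squares[of "\<lambda>s. \<bar>V s x\<bar>" S] by simp
    moreover have "\<kappa>\<^sup>2 \<le> (\<Sum>s\<in>S. \<bar>V s x\<bar>)\<^sup>2" if "(\<Sum>s\<in>S. \<bar>V s x\<bar>) > \<kappa>"
      using that \<open>\<kappa> > 0\<close> by (intro power_mono) auto
    ultimately have "\<kappa>\<^sup>2 \<le> (\<Sum>s\<in>S. (V s x)\<^sup>2) * card S" if "(\<Sum>s\<in>S. \<bar>V s x\<bar>) > \<kappa>"
      using that by linarith
    then show "indicator {x. (\<Sum>s\<in>S. \<bar>V s x\<bar>) > \<kappa>} x \<le> card S / \<kappa>\<^sup>2 * (\<Sum>s\<in>S. (V s x)\<^sup>2)"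
      using \<open>\<kappa> > 0\<close> by (auto simp: indicator_def field_simps sum_nonneg)
  qed simp_all
  also have "\<dots> = card S / \<kappa>\<^sup>2 * (\<Sum>s\<in>S. measure_pmf.expectation R (\<lambda>x. (V s x)\<^sup>2))"
    by simp
  also have "\<dots> \<le> card S / \<kappa>\<^sup>2 * (card S * v)"
    using sum_bounded_above[of S "\<lambda>s. measure_pmf.expectation R (\<lambda>x. (V s x)\<^sup>2)" v] v
    by (intro mult_left_mono) auto
  finally show ?thesis by (simp add: power2_eq_square mult_ac)
qed

lemma pmf_of_finite_prob_space:
  assumes "prob_space \<mu>" "finite (space \<mu>)" "sets \<mu> = Pow (space \<mu>)"
  obtains p where "set_pmf p \<subseteq> space \<mu>"
    "\<And>f :: 'a \<Rightarrow> real. (\<integral>x. f x \<partial>\<mu>) = (\<Sum>s\<in>space \<mu>. pmf p s * f s)"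
    "\<And>I A. finite I \<Longrightarrow> A \<subseteq> space (Pi\<^sub>M I (\<lambda>_. \<mu>)) \<Longrightarrow>
       measure (Pi\<^sub>M I (\<lambda>_. \<mu>)) A = measure_pmf.prob (Pi_pmf I undefined (\<lambda>_. p)) A"
proof -
  interpret prob_space \<mu> by fact
  let ?S = "space \<mu>"
  have "(\<Sum>s\<in>?S. prob {s}) = 1"
    using finite_measure_eq_sum_singleton[of ?S] assms prob_space by auto
  then obtain p where p: "\<And>x. pmf p x = (if x \<in> ?S then prob {x} else 0)"
    using pmf_exists_finite[of ?S "\<lambda>x. prob {x}"] assms by auto
  show thesis
  proof
    show "set_pmf p \<subseteq> ?S" by (auto simp: set_pmf_eq p split: if_splits)
    have "\<mu> = point_measure ?S (\<lambda>x. prob {x})"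
      by (rule measure_eqI_finite[of _ ?S]) (auto simp: assms sets_point_measure emeasure_point_measure_finite emeasure_eq_measure)
    then show "(\<integral>x. f x \<partial>\<mu>) = (\<Sum>s\<in>?S. pmf p s * f s)" for f :: "'a \<Rightarrow> real"
      using lebesgue_integral_point_measure_finite[of ?S "\<lambda>x. prob {x}" f] assms(2)
      by (simp add: p mult.commute cong: sum.cong)
    show "measure (Pi\<^sub>M I (\<lambda>_. \<mu>)) A = measure_pmf.prob (Pi_pmf I undefined (\<lambda>_. p)) A"
      if I: "finite I" and A: "A \<subseteq> space (Pi\<^sub>M I (\<lambda>_. \<mu>))" for I A
    proof -
      interpret PI: product_prob_space "\<lambda>_. \<mu>" I by unfold_locales
      have finA: "finite A"
        using A I assms(2) by (auto simp: space_PiM intro: finite_subset finite_PiE)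
      have single: "{x} = (\<Pi>\<^sub>E i\<in>I. {x i})" if "x \<in> A" for x
        using that A PiE_singleton[of x I] by (auto simp: space_PiM PiE_def)
      have mem: "x i \<in> ?S" if "x \<in> A" "i \<in> I" for x i
        using that A by (auto simp: space_PiM)
      have "measure (Pi\<^sub>M I (\<lambda>_. \<mu>)) A = (\<Sum>x\<in>A. measure (Pi\<^sub>M I (\<lambda>_. \<mu>)) {x})"
      proof (rule measure_eq_sum_singleton[OF finA])
        show "{x} \<in> sets (Pi\<^sub>M I (\<lambda>_. \<mu>))" if "x \<in> A" for x
          unfolding single[OF that] using I mem[OF that] assms(3) by (intro sets_PiM_I_finite) auto
        show "emeasure (Pi\<^sub>M I (\<lambda>_. \<mu>)) {x} \<noteq> \<infinity>" if "x \<in> A" for x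
          by (simp add: PI.P.emeasure_finite)
      qed
      also have "\<dots> = (\<Sum>x\<in>A. pmf (Pi_pmf I undefined (\<lambda>_. p)) x)"
      proof (rule sum.cong[OF refl])
        fix x assume x: "x \<in> A"
        have "emeasure (Pi\<^sub>M I (\<lambda>_. \<mu>)) {x} = (\<Prod>i\<in>I. emeasure \<mu> {x i})"
          unfolding single[OF x] using I mem[OF x] assms(3) by (intro PI.emeasure_PiM) auto
        also have "\<dots> = ennreal (\<Prod>i\<in>I. prob {x i})"
          by (simp add: emeasure_eq_measure prod_ennreal)
        finally have "measure (Pi\<^sub>M I (\<lambda>_. \<mu>)) {x} = (\<Prod>i\<in>I. prob {x i})"
          by (simp add: measure_def prod_nonneg)
        moreover have "x i = undefined" if "i \<notin> I" for i
          using x A that by (auto simp: space_PiM PiE_def extensional_def)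
        ultimately show "measure (Pi\<^sub>M I (\<lambda>_. \<mu>)) {x} = pmf (Pi_pmf I undefined (\<lambda>_. p)) x"
          using mem[OF x] I by (simp add: pmf_Pi p)
      qed
      also have "\<dots> = measure_pmf.prob (Pi_pmf I undefined (\<lambda>_. p)) A"
        using finA by (simp add: measure_measure_pmf_finite)
      finally show ?thesis .
    qed
  qed
qed

section \<open>Quantiles\<close>

lemma cdf_measure_pmf_distr: "cdf (measure_pmf R) = cdf (distr (measure_pmf R) borel (\<lambda>x::real. x))"
  by (auto simp: fun_eq_iff cdf_def measure_distr)

lemma real_distribution_distr_pmf: "real_distribution (distr (measure_pmf R) borel (\<lambda>x::real. x))"
  by (simp add: real_distribution_def real_distribution_axioms_def measure_pmf.prob_space_distr)

lemma
  assumes "0 < q"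
  shows bdd_below_cdf_ge: "bdd_below {t. cdf (measure_pmf R) t \<ge> q}"
    and quantile_pmf_le: "cdf (measure_pmf R) t \<ge> q \<Longrightarrow> quantile (cdf (measure_pmf R)) q \<le> t"
proof -
  interpret D: real_distribution "distr (measure_pmf R) borel (\<lambda>x. x)"
    by (rule real_distribution_distr_pmf)
  have "\<forall>\<^sub>F t in at_bot. cdf (measure_pmf R) t < q"
    using D.cdf_lim_at_bot \<open>0 < q\<close> unfolding cdf_measure_pmf_distr by (rule order_tendstoD)
  then obtain b where b: "\<And>t. t \<le> b \<Longrightarrow> cdf (measure_pmf R) t < q"
    by (auto simp: eventually_at_bot_linorder)
  show bdd: "bdd_below {t. cdf (measure_pmf R) t \<ge> q}"
    using b by (intro bdd_belowI[of _ b]) (metis mem_Collect_eq linorder_le_cases linorder_not_le)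
  show "quantile (cdf (measure_pmf R)) q \<le> t" if "cdf (measure_pmf R) t \<ge> q"
    unfolding quantile_def using bdd that by (intro cInf_lower) auto
qed

lemma
  assumes "q < 1"
  shows cdf_ge_nonempty: "{t. cdf (measure_pmf R) t \<ge> q} \<noteq> {}"
    and quantile_pmf_ge: "(\<And>t. cdf (measure_pmf R) t \<ge> q \<Longrightarrow> a \<le> t) \<Longrightarrow> a \<le> quantile (cdf (measure_pmf R)) q"
proof -
  interpret D: real_distribution "distr (measure_pmf R) borel (\<lambda>x. x)"
    by (rule real_distribution_distr_pmf)
  have "\<forall>\<^sub>F t in at_top. cdf (measure_pmf R) t > q"
    using D.cdf_lim_at_top_prob \<open>q < 1\<close> unfolding cdf_measure_pmf_distr by (rule order_tendstoD)
  then show ne: "{t. cdf (measure_pmf R) t \<ge> q} \<noteq> {}"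
    by (auto simp: eventually_at_top_linorder intro: less_imp_le)
  show "a \<le> quantile (cdf (measure_pmf R)) q" if "\<And>t. cdf (measure_pmf R) t \<ge> q \<Longrightarrow> a \<le> t"
    unfolding quantile_def using ne that by (intro cInf_greatest) auto
qed

lemma cdf_quantile_pmf_ge:
  assumes "0 < q" "q < 1"
  shows "q \<le> cdf (measure_pmf R) (quantile (cdf (measure_pmf R)) q)"
proof -
  interpret D: real_distribution "distr (measure_pmf R) borel (\<lambda>x. x)"
    by (rule real_distribution_distr_pmf)
  let ?F = "cdf (measure_pmf R)"
  let ?t = "quantile ?F q"
  have "(?F \<longlongrightarrow> ?F ?t) (at_right ?t)"
    using D.cdf_is_right_cont[of ?t] unfolding cdf_measure_pmf_distr continuous_within .
  moreover have "\<forall>\<^sub>F x in at_right ?t. q \<le> ?F x"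
    unfolding eventually_at_filter
  proof (intro always_eventually allI impI)
    fix x assume "x \<in> {?t<..}"
    then have "Inf {t. ?F t \<ge> q} < x" by (simp add: quantile_def)
    then obtain y where "?F y \<ge> q" "y < x"
      using cInf_less_iff[OF cdf_ge_nonempty[OF assms(2)] bdd_below_cdf_ge[OF assms(1)]] by blast
    moreover have "?F y \<le> ?F x"
      using \<open>y < x\<close> D.cdf_nondecreasing[of y x] by (simp add: cdf_measure_pmf_distr)
    ultimately show "q \<le> ?F x" by simp
  qed
  ultimately show ?thesis
    by (rule tendsto_lowerbound) simp
qed

section \<open>Sample frequencies\<close>

definition freq :: "nat \<Rightarrow> (nat \<Rightarrow> 'z) \<Rightarrow> 'z \<Rightarrow> real" where
  "freq n z s = emp_mean n z (indicator {s})"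

lemma emp_mean_eq_sum_freq:
  assumes "finite S" "\<And>i. i < n \<Longrightarrow> z i \<in> S"
  shows "emp_mean n z \<phi> = (\<Sum>s\<in>S. freq n z s * \<phi> s)"
proof -
  have "(\<Sum>s\<in>S. freq n z s * \<phi> s) = (\<Sum>s\<in>S. \<Sum>i<n. indicator {s} (z i) * \<phi> s) / n"
    by (simp add: freq_def emp_mean_def sum_divide_distrib[symmetric] sum_distrib_right)
  also have "(\<Sum>s\<in>S. \<Sum>i<n. indicator {s} (z i) * \<phi> s) = (\<Sum>i<n. \<Sum>s\<in>S. indicator {s} (z i) * \<phi> s)"
    by (rule sum.swap)
  also have "\<dots> = (\<Sum>i<n. \<phi> (z i))"
  proof (rule sum.cong[OF refl])
    fix i assume "i \<in> {..<n}"
    have "(\<Sum>s\<in>S. indicator {s} (z i) * \<phi> s) = (\<Sum>s\<in>S. if z i = s then \<phi> s else 0)"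
      by (intro sum.cong) (auto simp: indicator_def)
    then show "(\<Sum>s\<in>S. indicator {s} (z i) * \<phi> s) = \<phi> (z i)"
      using assms \<open>i \<in> {..<n}\<close> by simp
  qed
  finally show ?thesis by (simp add: emp_mean_def)
qed

lemma expectation_square_scaled_sum:
  fixes f :: "'a \<Rightarrow> real" and n :: nat
  assumes "finite (set_pmf p)" "measure_pmf.expectation p f = 0" "n > 0"
  shows "measure_pmf.expectation (Pi_pmf {..<n} d (\<lambda>_. p)) (\<lambda>x. ((\<Sum>i<n. f (x i)) / sqrt n)\<^sup>2)
           = measure_pmf.expectation p (\<lambda>a. (f a)\<^sup>2)"
  using expectation_square_sum_Pi_pmf[OF finite_lessThan assms(1,2), of n d] assms(3)
  by (simp add: power_divide)

lemma sqrt_times_freq_diff: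
  fixes n :: nat
  assumes "n > 0"
  shows "sqrt n * (freq n z s - c) = (\<Sum>i<n. indicator {s} (z i) - c) / sqrt n"
proof -
  have "(\<Sum>i<n. indicator {s} (z i) - c) = real n * (freq n z s - c)"
    using assms by (simp add: freq_def emp_mean_def sum_subtractf algebra_simps)
  then show ?thesis
    using assms by (simp add: real_div_sqrt divide_simps)
qed

lemma finite_set_Pi_pmf_const:
  "finite (set_pmf p) \<Longrightarrow> finite (set_pmf (Pi_pmf {..<n::nat} d (\<lambda>_. p)))"
  by (auto simp: set_Pi_pmf)

lemma set_Pi_pmf_const_subset:
  "set_pmf p \<subseteq> S \<Longrightarrow> set_pmf (Pi_pmf {..<n::nat} d (\<lambda>_. p)) \<subseteq> {..<n} \<rightarrow> S"
  by (auto simp: set_Pi_pmf PiE_dflt_def)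

lemma prob_freq_deviation_le:
  fixes n :: nat
  assumes p: "finite (set_pmf p)" and "n > 0" "\<kappa> > 0"
  shows "measure_pmf.prob (Pi_pmf {..<n} d (\<lambda>_. p))
    {z. (\<Sum>s\<in>S. \<bar>sqrt n * (freq n z s - pmf p s)\<bar>) > \<kappa>} \<le> (card S)\<^sup>2 / \<kappa>\<^sup>2"
proof -
  note [simp] = integrable_measure_pmf_finite[OF p]
  have "measure_pmf.expectation (Pi_pmf {..<n} d (\<lambda>_. p))
      (\<lambda>z. (sqrt n * (freq n z s - pmf p s))\<^sup>2) \<le> 1" for s
  proof -
    let ?f = "\<lambda>a. indicator {s} a - pmf p s"
    have "measure_pmf.expectation p ?f = 0"
      by (simp add: measure_pmf_single)
    then have "measure_pmf.expectation (Pi_pmf {..<n} d (\<lambda>_. p)) (\<lambda>z. (sqrt n * (freq n z s - pmf p s))\<^sup>2)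
        = measure_pmf.expectation p (\<lambda>a. (?f a)\<^sup>2)"
      using expectation_square_scaled_sum[of p ?f n d] p \<open>n > 0\<close>
      by (simp add: sqrt_times_freq_diff)
    also have "\<dots> \<le> measure_pmf.expectation p (\<lambda>a. 1)"
      using pmf_le_1[of p s] pmf_nonneg[of p s]
      by (intro integral_mono) (auto simp: indicator_def abs_square_le_1)
    finally show ?thesis by simp
  qed
  from prob_l1_norm_gt_le[OF finite_set_Pi_pmf_const[OF p] \<open>\<kappa> > 0\<close> this]
  show ?thesis by simp
qed

text \<open>Coupling each draw maximally makes the difference of the two normalised frequency processes
  a normalised sum of independent centred terms that vanish unless the coupled draws differ, so its
  variance is at most the total variation distance of \<open>p\<close> and \<open>q\<close>, whatever
  the sample size. This replaces a uniform central limit theorem.\<close>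

lemma prob_freq_process_coupling:
  assumes S: "finite S" and p: "set_pmf p \<subseteq> S" and q: "set_pmf q \<subseteq> S" and "n > 0" "\<kappa> > 0"
    and AB: "\<And>z w. z \<in> {..<n} \<rightarrow> S \<Longrightarrow> z \<in> A \<Longrightarrow>
        (\<Sum>s\<in>S. \<bar>sqrt n * (freq n w s - pmf p s) - sqrt n * (freq n z s - pmf q s)\<bar>) \<le> \<kappa> \<Longrightarrow> w \<in> B"
  shows "measure_pmf.prob (Pi_pmf {..<n} d (\<lambda>_. q)) A \<le> measure_pmf.prob (Pi_pmf {..<n} d (\<lambda>_. p)) B
     + (card S)\<^sup>2 * (\<Sum>s\<in>S. \<bar>pmf p s - pmf q s\<bar>) / \<kappa>\<^sup>2"
proof -
  obtain r where r: "set_pmf r \<subseteq> S \<times> S" "map_pmf fst r = p" "map_pmf snd r = q"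
    and neq: "measure_pmf.prob r {x. fst x \<noteq> snd x} \<le> (\<Sum>s\<in>S. \<bar>pmf p s - pmf q s\<bar>)"
    using maximal_coupling_pmf[OF S p q] by blast
  have fin: "finite (set_pmf r)" using r(1) S by (meson finite_SigmaI finite_subset)
  note [simp] = integrable_measure_pmf_finite[OF fin]
  define R where "R = Pi_pmf {..<n} (d, d) (\<lambda>_. r)"
  have Rp: "Pi_pmf {..<n} d (\<lambda>_. p) = map_pmf (\<lambda>x. fst \<circ> x) R"
    unfolding R_def r(2)[symmetric] by (rule Pi_pmf_map) auto
  have Rq: "Pi_pmf {..<n} d (\<lambda>_. q) = map_pmf (\<lambda>x. snd \<circ> x) R"
    unfolding R_def r(3)[symmetric] by (rule Pi_pmf_map) auto
  have suppR: "set_pmf R \<subseteq> {..<n} \<rightarrow> S \<times> S"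
    unfolding R_def by (rule set_Pi_pmf_const_subset[OF r(1)])
  define V where "V = (\<lambda>s x. sqrt n * (freq n (fst \<circ> x) s - pmf p s) - sqrt n * (freq n (snd \<circ> x) s - pmf q s))"
  have V: "measure_pmf.expectation R (\<lambda>x. (V s x)\<^sup>2) \<le> (\<Sum>s\<in>S. \<bar>pmf p s - pmf q s\<bar>)" for s
  proof -
    let ?g = "\<lambda>a. indicator {s} (fst a) - indicator {s} (snd a) :: real"
    let ?c = "pmf p s - pmf q s"
    let ?f = "\<lambda>a. ?g a - ?c"
    have "measure_pmf.expectation r (\<lambda>a. indicator {s} (fst a)) = pmf p s"
      unfolding r(2)[symmetric]
      using integral_map_pmf[of fst r "indicator {s} :: _ \<Rightarrow> real"] by (simp add: measure_pmf_single)
    moreover have "measure_pmf.expectation r (\<lambda>a. indicator {s} (snd a)) = pmf q s"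
      unfolding r(3)[symmetric]
      using integral_map_pmf[of snd r "indicator {s} :: _ \<Rightarrow> real"] by (simp add: measure_pmf_single)
    ultimately have Eg: "measure_pmf.expectation r ?g = ?c" by simp
    have "V s x = (\<Sum>i<n. ?f (x i)) / sqrt n" for x
      unfolding V_def sqrt_times_freq_diff[OF \<open>n > 0\<close>] diff_divide_distrib[symmetric] sum_subtractf[symmetric]
      by (simp add: algebra_simps)
    then have "measure_pmf.expectation R (\<lambda>x. (V s x)\<^sup>2) = measure_pmf.expectation r (\<lambda>a. (?f a)\<^sup>2)"
      using expectation_square_scaled_sum[OF fin _ \<open>n > 0\<close>, of ?f "(d, d)"] Eg by (simp add: R_def)
    also have "\<dots> = measure_pmf.expectation r (\<lambda>a. (?g a)\<^sup>2) - ?c\<^sup>2"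
    proof -
      have "measure_pmf.expectation r (\<lambda>a. (?f a)\<^sup>2) = measure_pmf.expectation r (\<lambda>a. (?g a)\<^sup>2 - 2 * ?c * ?g a + ?c\<^sup>2)"
        by (rule arg_cong[of _ _ "measure_pmf.expectation r"]) (simp add: fun_eq_iff power2_eq_square algebra_simps)
      also have "\<dots> = measure_pmf.expectation r (\<lambda>a. (?g a)\<^sup>2) - 2 * ?c * measure_pmf.expectation r ?g + ?c\<^sup>2"
        by (subst Bochner_Integration.integral_add Bochner_Integration.integral_diff integral_mult_right_zero
            | (rule integrable_measure_pmf_finite[OF fin]) | simp)+
      finally show ?thesis using Eg by (simp add: power2_eq_square)
    qed
    also have "\<dots> \<le> measure_pmf.expectation r (\<lambda>a. (?g a)\<^sup>2)" by simp
    also have "\<dots> \<le> measure_pmf.expectation r (indicator {x. fst x \<noteq> snd x})"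
      by (intro integral_mono) (auto simp: indicator_def)
    also have "\<dots> \<le> (\<Sum>s\<in>S. \<bar>pmf p s - pmf q s\<bar>)" using neq by simp
    finally show ?thesis .
  qed
  have "measure_pmf.prob (Pi_pmf {..<n} d (\<lambda>_. q)) A = measure_pmf.prob R {x. snd \<circ> x \<in> A}"
    by (simp add: Rq vimage_def)
  also have "\<dots> \<le> measure_pmf.prob R ({x. fst \<circ> x \<in> B} \<union> {x. (\<Sum>s\<in>S. \<bar>V s x\<bar>) > \<kappa>})"
  proof (rule measure_pmf.finite_measure_mono_AE)
    have "snd \<circ> x \<in> {..<n} \<rightarrow> S" if "x \<in> set_pmf R" for x
      using subsetD[OF suppR that] by (auto simp: Pi_iff mem_Times_iff)
    then have "fst \<circ> x \<in> B"
      if "x \<in> set_pmf R" "snd \<circ> x \<in> A" "(\<Sum>s\<in>S. \<bar>V s x\<bar>) \<le> \<kappa>" for x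
      using AB[of "snd \<circ> x" "fst \<circ> x"] that by (simp add: V_def)
    then show "AE x in measure_pmf R. x \<in> {x. snd \<circ> x \<in> A} \<longrightarrow>
        x \<in> {x. fst \<circ> x \<in> B} \<union> {x. (\<Sum>s\<in>S. \<bar>V s x\<bar>) > \<kappa>}"
      by (auto simp: AE_measure_pmf_iff not_less)
  qed simp
  also have "\<dots> \<le> measure_pmf.prob R {x. fst \<circ> x \<in> B} + measure_pmf.prob R {x. (\<Sum>s\<in>S. \<bar>V s x\<bar>) > \<kappa>}"
    by (rule measure_Un_le) auto
  also have "measure_pmf.prob R {x. fst \<circ> x \<in> B} = measure_pmf.prob (Pi_pmf {..<n} d (\<lambda>_. p)) B"
    by (simp add: Rp vimage_def)
  also have "measure_pmf.prob R {x. (\<Sum>s\<in>S. \<bar>V s x\<bar>) > \<kappa>} \<le> (card S)\<^sup>2 * (\<Sum>s\<in>S. \<bar>pmf p s - pmf q s\<bar>) / \<kappa>\<^sup>2"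
    using finite_set_Pi_pmf_const[OF fin] \<open>\<kappa> > 0\<close> V unfolding R_def by (rule prob_l1_norm_gt_le)
  finally show ?thesis by simp
qed

lemma resample_single_pmf:
  assumes "n > 0" "z \<in> {..<n} \<rightarrow> S"
  shows "pmf (map_pmf z (pmf_of_set {..<n})) s = freq n z s"
    and "set_pmf (map_pmf z (pmf_of_set {..<n})) \<subseteq> S"
proof -
  have ne: "{..<n} \<noteq> {}" using assms by auto
  have "pmf (map_pmf z (pmf_of_set {..<n})) s = card ({..<n} \<inter> z -` {s}) / n"
    using ne by (simp add: pmf_map measure_pmf_of_set)
  also have "real (card ({..<n} \<inter> z -` {s})) = (\<Sum>i<n. indicator {s} (z i))"
    by (simp add: indicator_def if_distrib sum.If_cases vimage_def Int_def)
  finally show "pmf (map_pmf z (pmf_of_set {..<n})) s = freq n z s"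
    by (simp add: freq_def emp_mean_def)
  show "set_pmf (map_pmf z (pmf_of_set {..<n})) \<subseteq> S"
    using ne assms(2) by (auto simp: set_pmf_of_set)
qed

section \<open>Suprema over test functions\<close>

definition linear_sup :: "'z measure \<Rightarrow> ('z \<Rightarrow> real) \<Rightarrow> (('z \<Rightarrow> real) \<Rightarrow> real) \<Rightarrow> real" where
  "linear_sup Z v h = (SUP \<phi>\<in>test_functions Z. (\<Sum>s\<in>space Z. v s * \<phi> s) + h \<phi>)"

lemma test_functions_nonempty: "test_functions Z \<noteq> {}"
  by (auto simp: test_functions_def PiE_eq_empty_iff)

lemma abs_linear_test_function_le:
  assumes "\<phi> \<in> test_functions Z"
  shows "\<bar>\<Sum>s\<in>space Z. v s * \<phi> s\<bar> \<le> (\<Sum>s\<in>space Z. \<bar>v s\<bar>)"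
proof -
  have "\<bar>v s * \<phi> s\<bar> \<le> \<bar>v s\<bar>" if "s \<in> space Z" for s
    using PiE_mem[OF assms[unfolded test_functions_def] that] mult_left_le[of "\<phi> s" "\<bar>v s\<bar>"]
    by (simp add: abs_mult)
  then show ?thesis by (intro order_trans[OF sum_abs sum_mono]) auto
qed

lemma bdd_above_linear_sup:
  assumes "\<And>\<phi>. \<phi> \<in> test_functions Z \<Longrightarrow> \<bar>h \<phi>\<bar> \<le> b"
  shows "bdd_above ((\<lambda>\<phi>. (\<Sum>s\<in>space Z. v s * \<phi> s) + h \<phi>) ` test_functions Z)"
proof (rule bdd_aboveI2)
  fix \<phi> assume "\<phi> \<in> test_functions Z"
  then show "(\<Sum>s\<in>space Z. v s * \<phi> s) + h \<phi> \<le> (\<Sum>s\<in>space Z. \<bar>v s\<bar>) + b"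
    using abs_linear_test_function_le[of \<phi> Z v] assms[of \<phi>] by linarith
qed

lemma linear_sup_upper:
  assumes "\<And>\<phi>. \<phi> \<in> test_functions Z \<Longrightarrow> \<bar>h \<phi>\<bar> \<le> b" "\<phi> \<in> test_functions Z"
  shows "(\<Sum>s\<in>space Z. v s * \<phi> s) + h \<phi> \<le> linear_sup Z v h"
  unfolding linear_sup_def by (rule cSUP_upper[OF assms(2) bdd_above_linear_sup[OF assms(1)]])

lemma linear_sup_least:
  assumes "\<And>\<phi>. \<phi> \<in> test_functions Z \<Longrightarrow> (\<Sum>s\<in>space Z. v s * \<phi> s) + h \<phi> \<le> c"
  shows "linear_sup Z v h \<le> c"
  unfolding linear_sup_def by (rule cSUP_least[OF test_functions_nonempty assms])

lemma linear_sup_lipschitz: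
  assumes h: "\<And>\<phi>. \<phi> \<in> test_functions Z \<Longrightarrow> \<bar>h \<phi>\<bar> \<le> b"
  shows "linear_sup Z v h \<le> linear_sup Z v' h + (\<Sum>s\<in>space Z. \<bar>v s - v' s\<bar>)"
proof (rule linear_sup_least)
  fix \<phi> assume \<phi>: "\<phi> \<in> test_functions Z"
  have "(\<Sum>s\<in>space Z. v s * \<phi> s) = (\<Sum>s\<in>space Z. v' s * \<phi> s) + (\<Sum>s\<in>space Z. (v s - v' s) * \<phi> s)"
    by (simp add: sum.distrib[symmetric] algebra_simps)
  then show "(\<Sum>s\<in>space Z. v s * \<phi> s) + h \<phi> \<le> linear_sup Z v' h + (\<Sum>s\<in>space Z. \<bar>v s - v' s\<bar>)"
    using linear_sup_upper[of Z h b \<phi> v', OF h \<phi>] abs_linear_test_function_le[OF \<phi>, of "\<lambda>s. v s - v' s"]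
    by linarith
qed

lemma linear_sup_scale:
  assumes h: "\<And>\<phi>. \<phi> \<in> test_functions Z \<Longrightarrow> \<bar>h \<phi>\<bar> \<le> b" and "l > 0"
  shows "linear_sup Z (\<lambda>s. l * v s) (\<lambda>\<phi>. l * h \<phi>) = l * linear_sup Z v h"
proof (rule antisym)
  have scale: "(\<Sum>s\<in>space Z. l * v s * \<phi> s) + l * h \<phi> = l * ((\<Sum>s\<in>space Z. v s * \<phi> s) + h \<phi>)" for \<phi>
    by (simp add: sum_distrib_left algebra_simps)
  have divide: "l * x \<le> y \<Longrightarrow> x \<le> y / l" for x y
    using \<open>l > 0\<close> by (simp add: pos_le_divide_eq mult.commute)
  have lh: "\<bar>l * h \<phi>\<bar> \<le> l * b" if "\<phi> \<in> test_functions Z" for \<phi>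
    using h[OF that] \<open>l > 0\<close> by (simp add: abs_mult)
  show "linear_sup Z (\<lambda>s. l * v s) (\<lambda>\<phi>. l * h \<phi>) \<le> l * linear_sup Z v h"
    using linear_sup_upper[OF h] \<open>l > 0\<close> by (intro linear_sup_least) (simp add: scale)
  have "linear_sup Z v h \<le> linear_sup Z (\<lambda>s. l * v s) (\<lambda>\<phi>. l * h \<phi>) / l"
  proof (rule linear_sup_least)
    fix \<phi> assume "\<phi> \<in> test_functions Z"
    from linear_sup_upper[of Z "\<lambda>\<phi>. l * h \<phi>", OF lh this, of "\<lambda>s. l * v s", unfolded scale]
    show "(\<Sum>s\<in>space Z. v s * \<phi> s) + h \<phi> \<le> linear_sup Z (\<lambda>s. l * v s) (\<lambda>\<phi>. l * h \<phi>) / l"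
      by (rule divide)
  qed
  then show "l * linear_sup Z v h \<le> linear_sup Z (\<lambda>s. l * v s) (\<lambda>\<phi>. l * h \<phi>)"
    using \<open>l > 0\<close> by (simp add: field_simps)
qed

section \<open>Size and power of the bootstrap test\<close>

locale finite_model =
  fixes Z :: "'z measure" and M :: "'z measure set"
  assumes finite_space: "finite (space Z)" and discrete: "sets Z = Pow (space Z)"
    and nonempty: "M \<noteq> {}" and prob_measures: "M \<subseteq> space (prob_algebra Z)"
begin

definition model_inf :: "('z \<Rightarrow> real) \<Rightarrow> real" where
  "model_inf \<phi> = (INF \<mu>\<in>M. - (\<integral>z. \<phi> z \<partial>\<mu>))"

lemma prob_algebra_space:
  assumes "\<mu> \<in> space (prob_algebra Z)"
  shows "prob_space \<mu>" "space \<mu> = space Z" "sets \<mu> = Pow (space Z)"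
  using assms discrete sets_eq_imp_space_eq[of \<mu> Z] by (auto simp: space_prob_algebra)

lemma integral_test_function_bounds:
  assumes "\<mu> \<in> space (prob_algebra Z)" "\<phi> \<in> test_functions Z"
  shows "0 \<le> (\<integral>z. \<phi> z \<partial>\<mu>)" "(\<integral>z. \<phi> z \<partial>\<mu>) \<le> 1"
proof -
  note \<mu> = prob_algebra_space[OF assms(1)]
  interpret prob_space \<mu> by (rule \<mu>)
  have \<phi>: "0 \<le> \<phi> z \<and> \<phi> z \<le> 1" if "z \<in> space \<mu>" for z
    using assms(2) that \<mu>(2) by (auto simp: test_functions_def dest: PiE_mem)
  show "0 \<le> (\<integral>z. \<phi> z \<partial>\<mu>)"
    using \<phi> by (intro Bochner_Integration.integral_nonneg) auto
  have "(\<integral>z. \<phi> z \<partial>\<mu>) \<le> (\<integral>z. 1 \<partial>\<mu>)"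
    using \<phi> by (intro integral_mono_AE' AE_I2) auto
  then show "(\<integral>z. \<phi> z \<partial>\<mu>) \<le> 1" by (simp add: prob_space)
qed

lemma model_inf_le:
  assumes "\<mu> \<in> M" "\<phi> \<in> test_functions Z"
  shows "(\<integral>z. \<phi> z \<partial>\<mu>) + model_inf \<phi> \<le> 0"
proof -
  have "model_inf \<phi> \<le> - (\<integral>z. \<phi> z \<partial>\<mu>)"
    unfolding model_inf_def using assms prob_measures integral_test_function_bounds
    by (intro cINF_lower bdd_belowI2[of _ "-1"]) auto
  then show ?thesis by simp
qed

lemma abs_model_inf_le:
  assumes "\<phi> \<in> test_functions Z"
  shows "\<bar>model_inf \<phi>\<bar> \<le> 1"
proof -
  obtain \<mu> where "\<mu> \<in> M" using nonempty by auto
  then have "model_inf \<phi> \<le> 0"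
    using model_inf_le[OF _ assms] integral_test_function_bounds[OF _ assms] prob_measures by force
  moreover have "-1 \<le> model_inf \<phi>"
    unfolding model_inf_def using integral_test_function_bounds[OF _ assms] prob_measures
    by (intro cINF_greatest[OF nonempty]) auto
  ultimately show ?thesis by simp
qed

lemma eta_eq:
  assumes "\<phi> \<in> test_functions Z"
  shows "eta M E \<phi> = E \<phi> + model_inf \<phi>"
proof -
  have "bdd_below ((\<lambda>\<mu>. - (\<integral>z. \<phi> z \<partial>\<mu>)) ` M)"
    using integral_test_function_bounds[OF _ assms] prob_measures by (intro bdd_belowI2[of _ "-1"]) auto
  from Inf_add_eq[OF this _, of "E \<phi>"] nonempty show ?thesis
    by (simp add: eta_def model_inf_def image_image)
qed

lemma T_stat_eq:
  assumes "\<And>\<phi>. \<phi> \<in> test_functions Z \<Longrightarrow> E \<phi> = (\<Sum>s\<in>space Z. v s * \<phi> s)"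
  shows "T_stat Z M E = linear_sup Z v model_inf"
  unfolding T_stat_def linear_sup_def by (intro SUP_cong refl) (simp add: eta_eq assms)

lemma T_stat_emp_mean:
  assumes "z \<in> {..<n} \<rightarrow> space Z"
  shows "T_stat Z M (emp_mean n z) = linear_sup Z (freq n z) model_inf"
  using assms by (intro T_stat_eq emp_mean_eq_sum_freq[OF finite_space]) auto

lemma boot_stat_eq:
  assumes z: "z \<in> {..<n} \<rightarrow> space Z" and z': "z' \<in> {..<n} \<rightarrow> space Z"
  shows "boot_stat Z M l n z z' =
    linear_sup Z (\<lambda>s. sqrt n * (freq n z' s - freq n z s) + l * freq n z s) (\<lambda>\<phi>. l * model_inf \<phi>)
      - l * linear_sup Z (freq n z) model_inf"
proof -
  have emp: "emp_mean n y \<phi> = (\<Sum>s\<in>space Z. freq n y s * \<phi> s)" if "y \<in> {..<n} \<rightarrow> space Z" for y \<phi>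
    using that by (intro emp_mean_eq_sum_freq[OF finite_space]) auto
  have "boot_process n z z' \<phi> + l * eta M (emp_mean n z) \<phi>
    = (\<Sum>s\<in>space Z. (sqrt n * (freq n z' s - freq n z s) + l * freq n z s) * \<phi> s) + l * model_inf \<phi>"
    if "\<phi> \<in> test_functions Z" for \<phi>
    using that
    by (simp add: boot_process_def eta_eq emp[OF z] emp[OF z'] sum_distrib_left sum_subtractf[symmetric]
        sum.distrib[symmetric] algebra_simps)
  then show ?thesis
    by (simp add: boot_stat_def T_stat_emp_mean[OF z] linear_sup_def cong: SUP_cong)
qed

lemma boot_stat_le:
  assumes "z \<in> {..<n} \<rightarrow> space Z" "z' \<in> {..<n} \<rightarrow> space Z" "l > 0"
  shows "boot_stat Z M l n z z' \<le> (\<Sum>s\<in>space Z. \<bar>sqrt n * (freq n z' s - freq n z s)\<bar>)"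
proof -
  have "\<bar>l * model_inf \<phi>\<bar> \<le> l" if "\<phi> \<in> test_functions Z" for \<phi>
    using abs_model_inf_le[OF that] \<open>l > 0\<close> by (simp add: abs_mult)
  from linear_sup_lipschitz[of Z "\<lambda>\<phi>. l * model_inf \<phi>", OF this,
      of "\<lambda>s. sqrt n * (freq n z' s - freq n z s) + l * freq n z s" "\<lambda>s. l * freq n z s"]
  show ?thesis
    using assms by (simp add: boot_stat_eq linear_sup_scale[of Z model_inf 1, OF abs_model_inf_le])
qed

lemma T_stat_diff_le:
  assumes z: "z \<in> {..<n} \<rightarrow> space Z"
    and p: "\<And>\<phi>. (\<integral>z. \<phi> z \<partial>\<mu>) = (\<Sum>s\<in>space Z. p s * \<phi> s)"
  shows "T_stat Z M (integral\<^sup>L \<mu>) \<le> T_stat Z M (emp_mean n z) + (\<Sum>s\<in>space Z. \<bar>freq n z s - p s\<bar>)"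
  using linear_sup_lipschitz[of Z model_inf 1 p "freq n z", OF abs_model_inf_le]
  by (simp add: T_stat_emp_mean[OF z] T_stat_eq[OF p] abs_minus_commute)

definition pivot :: "real \<Rightarrow> ('z \<Rightarrow> real) \<Rightarrow> nat \<Rightarrow> (nat \<Rightarrow> 'z) \<Rightarrow> real" where
  "pivot l p n w =
     linear_sup Z (\<lambda>s. sqrt n * (freq n w s - p s) + l * p s) (\<lambda>\<phi>. l * model_inf \<phi>)"

lemma T_stat_le_pivot:
  assumes z: "z \<in> {..<n} \<rightarrow> space Z" and \<mu>: "\<mu> \<in> M"
    and p: "\<And>\<phi>. (\<integral>z. \<phi> z \<partial>\<mu>) = (\<Sum>s\<in>space Z. p s * \<phi> s)"
    and l: "0 < l" "l \<le> sqrt n"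
  shows "sqrt n * T_stat Z M (emp_mean n z) \<le> pivot l p n z"
proof -
  have n: "sqrt n > 0" using l by linarith
  have lb: "\<bar>l * model_inf \<phi>\<bar> \<le> l" if "\<phi> \<in> test_functions Z" for \<phi>
    using abs_model_inf_le[OF that] \<open>l > 0\<close> by (simp add: abs_mult)
  have "sqrt n * T_stat Z M (emp_mean n z) =
      linear_sup Z (\<lambda>s. sqrt n * freq n z s) (\<lambda>\<phi>. sqrt n * model_inf \<phi>)"
    using linear_sup_scale[of Z model_inf 1, OF abs_model_inf_le n] by (simp add: T_stat_emp_mean[OF z])
  also have "\<dots> \<le> pivot l p n z"
    unfolding pivot_def
  proof (rule linear_sup_least)
    fix \<phi> assume \<phi>: "\<phi> \<in> test_functions Z"
    have "(\<Sum>s\<in>space Z. p s * \<phi> s) + model_inf \<phi> \<le> 0"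
      using model_inf_le[OF \<mu> \<phi>] p by simp
    then have "sqrt n * ((\<Sum>s\<in>space Z. p s * \<phi> s) + model_inf \<phi>)
        \<le> l * ((\<Sum>s\<in>space Z. p s * \<phi> s) + model_inf \<phi>)"
      using l by (intro mult_right_mono_neg)
    then have "(\<Sum>s\<in>space Z. sqrt n * freq n z s * \<phi> s) + sqrt n * model_inf \<phi>
        \<le> (\<Sum>s\<in>space Z. (sqrt n * (freq n z s - p s) + l * p s) * \<phi> s) + l * model_inf \<phi>"
      by (simp add: algebra_simps sum.distrib sum_subtractf sum_distrib_left)
    also have "\<dots> \<le> linear_sup Z (\<lambda>s. sqrt n * (freq n z s - p s) + l * p s) (\<lambda>\<phi>. l * model_inf \<phi>)"
      by (rule linear_sup_upper[OF lb \<phi>])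
    finally show "(\<Sum>s\<in>space Z. sqrt n * freq n z s * \<phi> s) + sqrt n * model_inf \<phi> \<le> \<dots>" .
  qed
  finally show ?thesis .
qed

lemma pivot_le_boot_stat:
  assumes z: "z \<in> {..<n} \<rightarrow> space Z" and z': "z' \<in> {..<n} \<rightarrow> space Z" and \<mu>: "\<mu> \<in> M"
    and p: "\<And>\<phi>. (\<integral>z. \<phi> z \<partial>\<mu>) = (\<Sum>s\<in>space Z. p s * \<phi> s)"
    and l: "0 < l"
  shows "pivot l p n w \<le> boot_stat Z M l n z z' + 2 * l * (\<Sum>s\<in>space Z. \<bar>freq n z s - p s\<bar>)
     + (\<Sum>s\<in>space Z. \<bar>sqrt n * (freq n w s - p s) - sqrt n * (freq n z' s - freq n z s)\<bar>)"
    (is "_ \<le> _ + 2 * l * ?D + ?K")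
proof -
  let ?v = "\<lambda>s. sqrt n * (freq n w s - p s) + l * p s"
  let ?v' = "\<lambda>s. sqrt n * (freq n z' s - freq n z s) + l * freq n z s"
  have lb: "\<bar>l * model_inf \<phi>\<bar> \<le> l" if "\<phi> \<in> test_functions Z" for \<phi>
    using abs_model_inf_le[OF that] \<open>l > 0\<close> by (simp add: abs_mult)
  have "(\<Sum>s\<in>space Z. \<bar>?v s - ?v' s\<bar>) \<le> (\<Sum>s\<in>space Z.
      \<bar>sqrt n * (freq n w s - p s) - sqrt n * (freq n z' s - freq n z s)\<bar> + l * \<bar>freq n z s - p s\<bar>)"
  proof (rule sum_mono)
    fix s
    have "?v s - ?v' s = (sqrt n * (freq n w s - p s) - sqrt n * (freq n z' s - freq n z s)) - l * (freq n z s - p s)"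
      by (simp add: algebra_simps)
    also have "\<bar>\<dots>\<bar> \<le> \<bar>sqrt n * (freq n w s - p s) - sqrt n * (freq n z' s - freq n z s)\<bar> + \<bar>l * (freq n z s - p s)\<bar>"
      by (rule abs_triangle_ineq4)
    finally show "\<bar>?v s - ?v' s\<bar> \<le> \<bar>sqrt n * (freq n w s - p s) - sqrt n * (freq n z' s - freq n z s)\<bar> + l * \<bar>freq n z s - p s\<bar>"
      using l by (simp add: abs_mult)
  qed
  also have "\<dots> = ?K + l * ?D" by (simp add: sum.distrib sum_distrib_left)
  finally have 1: "(\<Sum>s\<in>space Z. \<bar>?v s - ?v' s\<bar>) \<le> ?K + l * ?D" .
  have 2: "pivot l p n w \<le> linear_sup Z ?v' (\<lambda>\<phi>. l * model_inf \<phi>) + (\<Sum>s\<in>space Z. \<bar>?v s - ?v' s\<bar>)"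
    unfolding pivot_def by (rule linear_sup_lipschitz[OF lb])
  have "linear_sup Z p model_inf \<le> 0"
    using model_inf_le[OF \<mu>] p by (intro linear_sup_least) auto
  then have "linear_sup Z (freq n z) model_inf \<le> ?D"
    using linear_sup_lipschitz[of Z model_inf 1 "freq n z" p, OF abs_model_inf_le] by linarith
  then have "l * linear_sup Z (freq n z) model_inf \<le> l * ?D" using l by simp
  with 1 2 show ?thesis unfolding boot_stat_eq[OF z z'] by linarith
qed

lemma cdf_boot_stat:
  "cdf (measure_pmf (map_pmf (boot_stat Z M l n z) (resample_pmf n z))) t
    = measure_pmf.prob (resample_pmf n z) {z'. boot_stat Z M l n z z' \<le> t}"
  by (simp add: cdf_def vimage_def)

lemma boot_quantile_le:
  assumes z: "z \<in> {..<n} \<rightarrow> space Z" and "n > 0" "l > 0" and \<alpha>: "0 < \<alpha>" "\<alpha> < 1"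
    and t: "(card (space Z))\<^sup>2 / t\<^sup>2 \<le> \<alpha>" "t > 0"
  shows "boot_quantile Z M l n z (1 - \<alpha>) \<le> t"
proof -
  define q where "q = map_pmf z (pmf_of_set {..<n})"
  note q = resample_single_pmf[OF \<open>n > 0\<close> z, folded q_def]
  have fin: "finite (set_pmf q)" using q(2) finite_space finite_subset by blast
  have R: "resample_pmf n z = Pi_pmf {..<n} undefined (\<lambda>_. q)"
    by (simp add: resample_pmf_def q_def)
  let ?A = "{z'. boot_stat Z M l n z z' \<le> t}"
  have "measure_pmf.prob (resample_pmf n z) (- ?A)
      \<le> measure_pmf.prob (resample_pmf n z) {z'. (\<Sum>s\<in>space Z. \<bar>sqrt n * (freq n z' s - pmf q s)\<bar>) > t}"
    using boot_stat_le[OF z _ \<open>l > 0\<close>] set_Pi_pmf_const_subset[OF q(2), of n undefined]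
    by (intro measure_pmf.finite_measure_mono_AE) (force simp: AE_measure_pmf_iff R q(1))+
  also have "\<dots> \<le> (card (space Z))\<^sup>2 / t\<^sup>2"
    unfolding R by (rule prob_freq_deviation_le[OF fin \<open>n > 0\<close> \<open>t > 0\<close>])
  finally have "measure_pmf.prob (resample_pmf n z) ?A \<ge> 1 - \<alpha>"
    using t(1) measure_pmf.prob_compl[of ?A "resample_pmf n z"] by (simp add: Compl_eq_Diff_UNIV)
  then show ?thesis
    unfolding boot_quantile_def using \<alpha> \<open>n > 0\<close>
    by (intro quantile_pmf_le) (simp_all add: cdf_boot_stat)
qed

lemma boot_quantile_ge:
  fixes \<rho> :: real
  assumes z: "z \<in> {..<n} \<rightarrow> space Z" and n: "n > 0" and l: "l > 0" and \<alpha>: "0 < \<alpha>" and \<mu>: "\<mu> \<in> M"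
    and p: "set_pmf p \<subseteq> space Z" "\<And>f :: 'z \<Rightarrow> real. (\<integral>z. f z \<partial>\<mu>) = (\<Sum>s\<in>space Z. pmf p s * f s)"
    and D: "(\<Sum>s\<in>space Z. \<bar>freq n z s - pmf p s\<bar>) \<le> \<rho>" and "\<kappa> > 0"
    and \<beta>: "(card (space Z))\<^sup>2 * \<rho> / \<kappa>\<^sup>2 \<le> \<beta>" and \<alpha>\<beta>: "\<alpha> + \<beta> < 1"
  shows "quantile (cdf (measure_pmf (map_pmf (pivot l (pmf p) n) (Pi_pmf {..<n} undefined (\<lambda>_. p)))))
      (1 - \<alpha> - \<beta>) \<le> boot_quantile Z M l n z (1 - \<alpha>) + 2 * l * \<rho> + \<kappa>"
    (is "?t0 \<le> _")
proof -
  define q where "q = map_pmf z (pmf_of_set {..<n})"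
  note q = resample_single_pmf[OF n z, folded q_def]
  have R: "resample_pmf n z = Pi_pmf {..<n} undefined (\<lambda>_. q)"
    by (simp add: resample_pmf_def q_def)
  have "?t0 - (2 * l * \<rho> + \<kappa>) \<le> boot_quantile Z M l n z (1 - \<alpha>)"
    unfolding boot_quantile_def
  proof (rule quantile_pmf_ge)
    fix t assume t: "1 - \<alpha> \<le> cdf (measure_pmf (map_pmf (boot_stat Z M l n z) (resample_pmf n z))) t"
    have "measure_pmf.prob (Pi_pmf {..<n} undefined (\<lambda>_. q)) {z'. boot_stat Z M l n z z' \<le> t}
        \<le> measure_pmf.prob (Pi_pmf {..<n} undefined (\<lambda>_. p)) {w. pivot l (pmf p) n w \<le> t + (2 * l * \<rho> + \<kappa>)}
          + (card (space Z))\<^sup>2 * (\<Sum>s\<in>space Z. \<bar>pmf p s - pmf q s\<bar>) / \<kappa>\<^sup>2"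
    proof (rule prob_freq_process_coupling[OF finite_space p(1) q(2) n \<open>\<kappa> > 0\<close>])
      fix z' w assume z': "z' \<in> {..<n} \<rightarrow> space Z" "z' \<in> {z'. boot_stat Z M l n z z' \<le> t}"
        and \<kappa>: "(\<Sum>s\<in>space Z. \<bar>sqrt n * (freq n w s - pmf p s) - sqrt n * (freq n z' s - pmf q s)\<bar>) \<le> \<kappa>"
      have "2 * l * (\<Sum>s\<in>space Z. \<bar>freq n z s - pmf p s\<bar>) \<le> 2 * l * \<rho>"
        using D l by (intro mult_left_mono) auto
      then show "w \<in> {w. pivot l (pmf p) n w \<le> t + (2 * l * \<rho> + \<kappa>)}"
        using pivot_le_boot_stat[OF z z'(1) \<mu> p(2) l, of w] z'(2) \<kappa> by (simp add: q(1))
    qed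
    moreover have "(card (space Z))\<^sup>2 * (\<Sum>s\<in>space Z. \<bar>pmf p s - pmf q s\<bar>) / \<kappa>\<^sup>2
        \<le> (card (space Z))\<^sup>2 * \<rho> / \<kappa>\<^sup>2"
      using D by (intro divide_right_mono mult_left_mono) (simp_all add: q(1) abs_minus_commute[of "pmf p _"])
    ultimately have "1 - \<alpha> - \<beta>
        \<le> measure_pmf.prob (Pi_pmf {..<n} undefined (\<lambda>_. p)) {w. pivot l (pmf p) n w \<le> t + (2 * l * \<rho> + \<kappa>)}"
      using t[unfolded cdf_boot_stat] \<beta> unfolding R by linarith
    then have "?t0 \<le> t + (2 * l * \<rho> + \<kappa>)"
      using \<alpha>\<beta> by (intro quantile_pmf_le) (simp_all add: cdf_def vimage_def)
    then show "?t0 - (2 * l * \<rho> + \<kappa>) \<le> t" by simp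
  qed (use \<alpha> in simp)
  then show ?thesis by simp
qed

lemma accept_prob_eq:
  assumes \<mu>: "\<mu> \<in> space (prob_algebra Z)"
  obtains p where "set_pmf p \<subseteq> space Z"
    "\<And>f :: 'z \<Rightarrow> real. (\<integral>z. f z \<partial>\<mu>) = (\<Sum>s\<in>space Z. pmf p s * f s)"
    "\<And>l \<alpha> \<epsilon> n. accept_prob Z M l \<alpha> \<epsilon> n \<mu> = measure_pmf.prob (Pi_pmf {..<n} undefined (\<lambda>_. p))
      {z. sqrt n * T_stat Z M (emp_mean n z) \<le> boot_quantile Z M l n z (1 - \<alpha>) + \<epsilon>}"
proof -
  note sp = prob_algebra_space[OF \<mu>]
  have fin: "finite (space \<mu>)" using finite_space by (simp add: sp(2))
  obtain p where p: "set_pmf p \<subseteq> space Z"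
    "\<And>f :: 'z \<Rightarrow> real. (\<integral>z. f z \<partial>\<mu>) = (\<Sum>s\<in>space Z. pmf p s * f s)"
    "\<And>(I :: nat set) A. finite I \<Longrightarrow> A \<subseteq> space (Pi\<^sub>M I (\<lambda>_. \<mu>)) \<Longrightarrow>
       measure (Pi\<^sub>M I (\<lambda>_. \<mu>)) A = measure_pmf.prob (Pi_pmf I undefined (\<lambda>_. p)) A"
    by (rule pmf_of_finite_prob_space[OF sp(1) fin]) (auto simp: sp)
  show thesis
  proof (rule that[OF p(1,2)])
    fix l \<alpha> \<epsilon> :: real and n :: nat
    let ?A = "{z. sqrt n * T_stat Z M (emp_mean n z) \<le> boot_quantile Z M l n z (1 - \<alpha>) + \<epsilon>}"
    have "accept_prob Z M l \<alpha> \<epsilon> n \<mu> = measure (Pi\<^sub>M {..<n} (\<lambda>_. \<mu>)) ({z \<in> space (Pi\<^sub>M {..<n} (\<lambda>_. \<mu>)). z \<in> ?A})"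
      by (simp add: accept_prob_def)
    also have "\<dots> = measure_pmf.prob (Pi_pmf {..<n} undefined (\<lambda>_. p)) {z \<in> space (Pi\<^sub>M {..<n} (\<lambda>_. \<mu>)). z \<in> ?A}"
      by (rule p(3)) auto
    also have "\<dots> = measure_pmf.prob (Pi_pmf {..<n} undefined (\<lambda>_. p)) ?A"
    proof (rule measure_pmf.finite_measure_eq_AE)
      have "z \<in> space (Pi\<^sub>M {..<n} (\<lambda>_. \<mu>))" if "z \<in> set_pmf (Pi_pmf {..<n} undefined (\<lambda>_. p))" for z
        using that p(1) by (auto simp: set_Pi_pmf PiE_dflt_def space_PiM sp(2) PiE_def extensional_def)
      then show "AE z in measure_pmf (Pi_pmf {..<n} undefined (\<lambda>_. p)).
          (z \<in> {z \<in> space (Pi\<^sub>M {..<n} (\<lambda>_. \<mu>)). z \<in> ?A}) = (z \<in> ?A)"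
        by (auto simp: AE_measure_pmf_iff)
    qed auto
    finally show "accept_prob Z M l \<alpha> \<epsilon> n \<mu> = measure_pmf.prob (Pi_pmf {..<n} undefined (\<lambda>_. p)) ?A" .
  qed
qed

lemma accept_prob_size:
  assumes \<mu>: "\<mu> \<in> M" and n: "n > 0" and l: "0 < l" "l \<le> sqrt n"
    and \<alpha>: "0 < \<alpha>" "\<alpha> < 1" and \<epsilon>: "\<epsilon> > 0"
  shows "1 - \<alpha> - 2 * (card (space Z))\<^sup>2 / (\<epsilon> * l) - 64 * (card (space Z))\<^sup>2 * (l / sqrt n)\<^sup>2 / \<epsilon>\<^sup>2
    \<le> accept_prob Z M l \<alpha> \<epsilon> n \<mu>"
proof -
  obtain p where p: "set_pmf p \<subseteq> space Z"
    "\<And>f :: 'z \<Rightarrow> real. (\<integral>z. f z \<partial>\<mu>) = (\<Sum>s\<in>space Z. pmf p s * f s)"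
    "\<And>l \<alpha> \<epsilon> n. accept_prob Z M l \<alpha> \<epsilon> n \<mu> = measure_pmf.prob (Pi_pmf {..<n} undefined (\<lambda>_. p))
      {z. sqrt n * T_stat Z M (emp_mean n z) \<le> boot_quantile Z M l n z (1 - \<alpha>) + \<epsilon>}"
    using accept_prob_eq \<mu> prob_measures by blast
  have fin: "finite (set_pmf p)" using p(1) finite_space finite_subset by blast
  let ?d2 = "(card (space Z))\<^sup>2"
  let ?P = "Pi_pmf {..<n} undefined (\<lambda>_. p)"
  let ?A = "{z. sqrt n * T_stat Z M (emp_mean n z) \<le> boot_quantile Z M l n z (1 - \<alpha>) + \<epsilon>}"
  define \<rho> where "\<rho> = \<epsilon> / (8 * l)"
  define \<beta> where "\<beta> = 2 * ?d2 / (\<epsilon> * l)"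
  have \<rho>: "\<rho> > 0" using \<epsilon> l by (simp add: \<rho>_def)
  show ?thesis
  proof (cases "\<alpha> + \<beta> < 1")
    case False
    have "0 \<le> 64 * ?d2 * (l / sqrt n)\<^sup>2 / \<epsilon>\<^sup>2" by simp
    with False have "1 - \<alpha> - \<beta> - 64 * ?d2 * (l / sqrt n)\<^sup>2 / \<epsilon>\<^sup>2 \<le> 0" by linarith
    also have "0 \<le> accept_prob Z M l \<alpha> \<epsilon> n \<mu>" by (simp add: p(3))
    finally show ?thesis by (simp add: \<beta>_def)
  next
    case True
    have \<beta>0: "0 \<le> \<beta>" using \<epsilon> l by (simp add: \<beta>_def)
    let ?R = "map_pmf (pivot l (pmf p) n) ?P"
    define t0 where "t0 = quantile (cdf (measure_pmf ?R)) (1 - \<alpha> - \<beta>)"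
    define B where "B = {z. (\<Sum>s\<in>space Z. \<bar>sqrt n * (freq n z s - pmf p s)\<bar>) > sqrt n * \<rho>}"
    have "1 - \<alpha> - \<beta> \<le> cdf (measure_pmf ?R) t0"
      unfolding t0_def using True \<alpha> \<beta>0 by (intro cdf_quantile_pmf_ge) auto
    also have "\<dots> = measure_pmf.prob ?P {z. pivot l (pmf p) n z \<le> t0}"
      by (simp add: cdf_def vimage_def)
    also have "\<dots> \<le> measure_pmf.prob ?P (?A \<union> B)"
    proof (rule measure_pmf.finite_measure_mono_AE)
      have "z \<in> ?A \<union> B" if z: "z \<in> {..<n} \<rightarrow> space Z" and pz: "pivot l (pmf p) n z \<le> t0" for z
      proof (cases "z \<in> B")
        case False
        then have "(\<Sum>s\<in>space Z. \<bar>freq n z s - pmf p s\<bar>) \<le> \<rho>"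
          using n by (simp add: B_def abs_mult sum_distrib_left[symmetric])
        moreover have "?d2 * \<rho> / (\<epsilon> / 4)\<^sup>2 \<le> \<beta>"
          using l \<epsilon> by (simp add: \<rho>_def \<beta>_def field_simps power2_eq_square)
        ultimately have "t0 \<le> boot_quantile Z M l n z (1 - \<alpha>) + 2 * l * \<rho> + \<epsilon> / 4"
          unfolding t0_def using True \<epsilon> \<alpha> by (intro boot_quantile_ge[OF z n l(1) _ \<mu> p(1,2)]) auto
        also have "2 * l * \<rho> = \<epsilon> / 4" using l by (simp add: \<rho>_def)
        finally have "t0 \<le> boot_quantile Z M l n z (1 - \<alpha>) + \<epsilon>" using \<epsilon> by simp
        then have "z \<in> ?A"
          using pz T_stat_le_pivot[OF z \<mu> p(2) l] by simp
        then show ?thesis ..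
      qed simp
      then show "AE z in measure_pmf ?P. z \<in> {z. pivot l (pmf p) n z \<le> t0} \<longrightarrow> z \<in> ?A \<union> B"
        using set_Pi_pmf_const_subset[OF p(1), of n undefined] by (auto simp: AE_measure_pmf_iff)
    qed simp
    also have "\<dots> \<le> measure_pmf.prob ?P ?A + measure_pmf.prob ?P B"
      by (rule measure_Un_le) auto
    also have "measure_pmf.prob ?P B \<le> ?d2 / (sqrt n * \<rho>)\<^sup>2"
      unfolding B_def using \<rho> n by (intro prob_freq_deviation_le[OF fin n]) simp
    also have "?d2 / (sqrt n * \<rho>)\<^sup>2 = 64 * ?d2 * (l / sqrt n)\<^sup>2 / \<epsilon>\<^sup>2"
      using n l \<epsilon> by (simp add: \<rho>_def field_simps power2_eq_square)
    finally show ?thesis by (simp add: p(3) \<beta>_def)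
  qed
qed

lemma accept_prob_power:
  assumes \<mu>: "\<mu> \<in> space (prob_algebra Z)" and n: "n > 0" and l: "0 < l"
    and \<alpha>: "0 < \<alpha>" "\<alpha> < 1"
    and T: "T_stat Z M (integral\<^sup>L \<mu>) \<ge> \<Delta> / sqrt n"
    and \<Delta>: "\<Delta> > card (space Z) / sqrt \<alpha> + \<epsilon>"
  shows "accept_prob Z M l \<alpha> \<epsilon> n \<mu>
    \<le> 4 * (card (space Z))\<^sup>2 / (\<Delta> - card (space Z) / sqrt \<alpha> - \<epsilon>)\<^sup>2"
proof -
  obtain p where p: "set_pmf p \<subseteq> space Z"
    "\<And>f :: 'z \<Rightarrow> real. (\<integral>z. f z \<partial>\<mu>) = (\<Sum>s\<in>space Z. pmf p s * f s)"
    "\<And>l \<alpha> \<epsilon> n. accept_prob Z M l \<alpha> \<epsilon> n \<mu> = measure_pmf.prob (Pi_pmf {..<n} undefined (\<lambda>_. p))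
      {z. sqrt n * T_stat Z M (emp_mean n z) \<le> boot_quantile Z M l n z (1 - \<alpha>) + \<epsilon>}"
    using accept_prob_eq \<mu> by blast
  have fin: "finite (set_pmf p)" using p(1) finite_space finite_subset by blast
  let ?C = "card (space Z) / sqrt \<alpha>"
  let ?P = "Pi_pmf {..<n} undefined (\<lambda>_. p)"
  define x where "x = \<Delta> - ?C - \<epsilon>"
  have x: "x > 0" using \<Delta> by (simp add: x_def)
  have "card (space Z) > 0"
    using finite_space p(1) set_pmf_not_empty[of p] by (auto simp: card_gt_0_iff)
  then have C: "?C > 0" "(card (space Z))\<^sup>2 / ?C\<^sup>2 \<le> \<alpha>"
    using \<alpha> by (auto simp: power_divide)
  have "accept_prob Z M l \<alpha> \<epsilon> n \<mu> = measure_pmf.prob ?P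
      {z. sqrt n * T_stat Z M (emp_mean n z) \<le> boot_quantile Z M l n z (1 - \<alpha>) + \<epsilon>}" by (rule p(3))
  also have "\<dots> \<le> measure_pmf.prob ?P {z. (\<Sum>s\<in>space Z. \<bar>sqrt n * (freq n z s - pmf p s)\<bar>) > x / 2}"
  proof (rule measure_pmf.finite_measure_mono_AE)
    have "(\<Sum>s\<in>space Z. \<bar>sqrt n * (freq n z s - pmf p s)\<bar>) > x / 2"
      if z: "z \<in> {..<n} \<rightarrow> space Z"
        and acc: "sqrt n * T_stat Z M (emp_mean n z) \<le> boot_quantile Z M l n z (1 - \<alpha>) + \<epsilon>" for z
    proof -
      let ?D = "\<Sum>s\<in>space Z. \<bar>freq n z s - pmf p s\<bar>"
      have "\<Delta> \<le> sqrt n * T_stat Z M (integral\<^sup>L \<mu>)"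
        using T n by (simp add: field_simps)
      also have "\<dots> \<le> sqrt n * (T_stat Z M (emp_mean n z) + ?D)"
        using T_stat_diff_le[OF z p(2)] by (intro mult_left_mono) auto
      also have "\<dots> \<le> ?C + \<epsilon> + sqrt n * ?D"
        using acc boot_quantile_le[OF z n l \<alpha> C(2,1)] by (simp add: distrib_left)
      finally show ?thesis
        using x by (simp add: x_def abs_mult sum_distrib_left)
    qed
    then show "AE z in measure_pmf ?P.
        z \<in> {z. sqrt n * T_stat Z M (emp_mean n z) \<le> boot_quantile Z M l n z (1 - \<alpha>) + \<epsilon>} \<longrightarrow>
        z \<in> {z. (\<Sum>s\<in>space Z. \<bar>sqrt n * (freq n z s - pmf p s)\<bar>) > x / 2}"
      using set_Pi_pmf_const_subset[OF p(1), of n undefined] by (auto simp: AE_measure_pmf_iff)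
  qed simp
  also have "\<dots> \<le> (card (space Z))\<^sup>2 / (x / 2)\<^sup>2"
    using x by (intro prob_freq_deviation_le[OF fin n]) simp
  finally show ?thesis by (simp add: x_def power_divide mult.commute)
qed

end

lemma subset_tv_closure:
  assumes "S \<subseteq> space (prob_algebra Z)"
  shows "S \<subseteq> tv_closure Z S"
proof
  fix \<mu> assume "\<mu> \<in> S"
  moreover have "tv_dist Z \<mu> \<mu> = 0"
  proof -
    have "sets Z \<noteq> {}" using sets.top by blast
    then show ?thesis by (simp add: tv_dist_def)
  qed
  ultimately show "\<mu> \<in> tv_closure Z S"
    using assms by (force simp: tv_closure_def)
qed

theorem corollary1:
  fixes Y :: "'y measure" and X :: "'x measure" and U :: "'u measure"
    and \<Theta> :: "'p set" and J :: "'j set" and K :: "'k set"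
    and g1 :: "'p \<Rightarrow> 'j \<Rightarrow> 'x \<times> 'u \<Rightarrow> real" and g2 :: "'p \<Rightarrow> 'k \<Rightarrow> 'x \<times> 'u \<Rightarrow> real"
    and kern :: "'p \<Rightarrow> 'x \<times> 'u \<Rightarrow> ('y \<times> 'x) measure"
    and P :: "('y \<times> 'x) measure set"
    and lam :: "nat \<Rightarrow> real" and \<alpha> \<epsilon> :: real
  defines "W \<equiv> X \<Otimes>\<^sub>M U" and "Z \<equiv> Y \<Otimes>\<^sub>M X"
  defines "\<Gamma> \<equiv> (\<lambda>\<theta>. moment_measures W J K (g1 \<theta>) (g2 \<theta>))"
  defines "Mbar \<equiv> (\<lambda>\<theta>. tv_closure Z ((\<lambda>\<gamma>. \<gamma> \<bind> kern \<theta>) ` \<Gamma> \<theta>))"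
  assumes g1_measurable: "\<And>\<theta> j. \<theta> \<in> \<Theta> \<Longrightarrow> j \<in> J \<Longrightarrow> g1 \<theta> j \<in> borel_measurable W"
    and g2_measurable: "\<And>\<theta> k. \<theta> \<in> \<Theta> \<Longrightarrow> k \<in> K \<Longrightarrow> g2 \<theta> k \<in> borel_measurable W"
    and kernel: "\<And>\<theta>. \<theta> \<in> \<Theta> \<Longrightarrow> kern \<theta> \<in> W \<rightarrow>\<^sub>M prob_algebra Z"
    and kernel_marginal: "\<And>\<theta> x u. \<theta> \<in> \<Theta> \<Longrightarrow> x \<in> space X \<Longrightarrow> u \<in> space U \<Longrightarrow>
          distr (kern \<theta> (x, u)) X snd = return X x"
    and Z_finite: "finite (space Z)" and Z_discrete: "sets Z = Pow (space Z)"
    and \<Gamma>_nonempty: "\<And>\<theta>. \<theta> \<in> \<Theta> \<Longrightarrow> \<Gamma> \<theta> \<noteq> {}"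
    and P: "P \<subseteq> space (prob_algebra Z)"
    and lam_pos: "\<And>n. n > 0 \<Longrightarrow> lam n > 0"
    and lam_at_top: "filterlim lam at_top sequentially"
    and lam_smallo: "lam \<in> o(\<lambda>n. sqrt (real n))"
    and \<alpha>: "0 < \<alpha>" "\<alpha> < 1" and \<epsilon>: "\<epsilon> > 0"
  shows "liminf (\<lambda>n. ereal (inf_prob (SIGMA \<mu>:P. identified_set \<Theta> Mbar \<mu>)
             (\<lambda>(\<mu>, \<theta>). accept_prob Z (Mbar \<theta>) (lam n) \<alpha> \<epsilon> n \<mu>))) \<ge> ereal (1 - \<alpha>)
       \<and> Limsup at_top (\<lambda>\<Delta>::real. limsup (\<lambda>n.
           ereal (sup_prob (SIGMA \<mu>:P. alternatives Z \<Theta> Mbar n \<Delta> \<mu>)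
             (\<lambda>(\<mu>, \<theta>). accept_prob Z (Mbar \<theta>) (lam n) \<alpha> \<epsilon> n \<mu>)))) = 0"
proof
  have model: "finite_model Z (Mbar \<theta>)" if "\<theta> \<in> \<Theta>" for \<theta>
  proof
    have "(\<lambda>\<gamma>. \<gamma> \<bind> kern \<theta>) ` \<Gamma> \<theta> \<subseteq> space (prob_algebra Z)"
      using prob_space_bind'[OF _ kernel[OF that]] sets_bind'[OF _ kernel[OF that]]
      by (auto simp: \<Gamma>_def moment_measures_def space_prob_algebra[of Z])
    then show "Mbar \<theta> \<noteq> {}"
      using subset_tv_closure \<Gamma>_nonempty[OF that] unfolding Mbar_def by blast
    show "Mbar \<theta> \<subseteq> space (prob_algebra Z)"
      by (auto simp: Mbar_def tv_closure_def)
  qed (fact Z_finite Z_discrete)+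
  let ?d2 = "(card (space Z))\<^sup>2"
  define b where "b = (\<lambda>n. 1 - \<alpha> - 2 * ?d2 / (\<epsilon> * lam n) - 64 * ?d2 * (lam n / sqrt n)\<^sup>2 / \<epsilon>\<^sup>2)"
  have ratio: "(\<lambda>n. lam n / sqrt n) \<longlonglongrightarrow> 0"
    using lam_smallo by (rule smalloD_tendsto)
  have "(\<lambda>n. 2 * ?d2 / \<epsilon> / lam n) \<longlonglongrightarrow> 0"
    by (rule real_tendsto_divide_at_top[OF tendsto_const lam_at_top])
  moreover have "(\<lambda>n. 64 * ?d2 / \<epsilon>\<^sup>2 * (lam n / sqrt n)\<^sup>2) \<longlonglongrightarrow> 0"
    by (rule tendsto_mult_right_zero) (use tendsto_power[OF ratio, of 2] in simp)
  ultimately have "(\<lambda>n. 1 - \<alpha> - 2 * ?d2 / \<epsilon> / lam n - 64 * ?d2 / \<epsilon>\<^sup>2 * (lam n / sqrt n)\<^sup>2)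
      \<longlonglongrightarrow> 1 - \<alpha> - 0 - 0"
    by (intro tendsto_diff tendsto_const)
  then have b: "b \<longlonglongrightarrow> 1 - \<alpha>"
    by (simp add: b_def)
  show "ereal (1 - \<alpha>) \<le> liminf (\<lambda>n. ereal (inf_prob (SIGMA \<mu>:P. identified_set \<Theta> Mbar \<mu>)
             (\<lambda>(\<mu>, \<theta>). accept_prob Z (Mbar \<theta>) (lam n) \<alpha> \<epsilon> n \<mu>)))"
  proof -
    have "\<forall>\<^sub>F n in sequentially. lam n / sqrt n < 1"
      using order_tendstoD(2)[OF ratio, of 1] by simp
    then have "\<forall>\<^sub>F n in sequentially. ereal (b n) \<le> ereal (inf_prob (SIGMA \<mu>:P. identified_set \<Theta> Mbar \<mu>)
             (\<lambda>(\<mu>, \<theta>). accept_prob Z (Mbar \<theta>) (lam n) \<alpha> \<epsilon> n \<mu>))"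
      using eventually_gt_at_top[of 0]
    proof eventually_elim
      case (elim n)
      have l: "0 < lam n" "lam n \<le> sqrt n"
        using elim lam_pos by (auto simp: divide_simps)
      have "b n \<le> accept_prob Z (Mbar \<theta>) (lam n) \<alpha> \<epsilon> n \<mu>"
        if "\<theta> \<in> identified_set \<Theta> Mbar \<mu>" for \<mu> \<theta>
        unfolding b_def using that elim
        by (intro finite_model.accept_prob_size[OF model _ _ l \<alpha> \<epsilon>]) (auto simp: identified_set_def)
      moreover have "b n \<le> 1"
      proof -
        have "0 \<le> 2 * ?d2 / (\<epsilon> * lam n)" "0 \<le> 64 * ?d2 * (lam n / sqrt n)\<^sup>2 / \<epsilon>\<^sup>2"
          using l \<epsilon> by auto
        then show ?thesis using \<alpha> unfolding b_def by linarith
      qed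
      ultimately show ?case
        by (auto simp: inf_prob_def intro!: cINF_greatest)
    qed
    then have "liminf (\<lambda>n. ereal (b n)) \<le> liminf (\<lambda>n. ereal (inf_prob (SIGMA \<mu>:P. identified_set \<Theta> Mbar \<mu>)
             (\<lambda>(\<mu>, \<theta>). accept_prob Z (Mbar \<theta>) (lam n) \<alpha> \<epsilon> n \<mu>)))"
      by (rule Liminf_mono)
    moreover have "liminf (\<lambda>n. ereal (b n)) = ereal (1 - \<alpha>)"
      using b by (intro lim_imp_Liminf) auto
    ultimately show ?thesis by simp
  qed
  let ?s = "\<lambda>\<Delta> n. sup_prob (SIGMA \<mu>:P. alternatives Z \<Theta> Mbar n \<Delta> \<mu>)
             (\<lambda>(\<mu>, \<theta>). accept_prob Z (Mbar \<theta>) (lam n) \<alpha> \<epsilon> n \<mu>)"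
  define C where "C = card (space Z) / sqrt \<alpha> + \<epsilon>"
  have nonneg: "0 \<le> ?s \<Delta> n" for \<Delta> n
  proof (cases "(SIGMA \<mu>:P. alternatives Z \<Theta> Mbar n \<Delta> \<mu>) = {}")
    case False
    have le_1: "accept_prob Z (Mbar \<theta>) (lam n) \<alpha> \<epsilon> n \<mu> \<le> 1" if "\<mu> \<in> P" for \<mu> \<theta>
    proof -
      interpret prob_space \<mu>
        using that P by (auto simp: space_prob_algebra)
      have "prob_space (Pi\<^sub>M {..<n} (\<lambda>_. \<mu>))"
        by (intro prob_space_PiM prob_space_axioms)
      then show ?thesis unfolding accept_prob_def by (rule prob_space.prob_le_1)
    qed
    from False obtain \<mu> \<theta> where m: "(\<mu>, \<theta>) \<in> (SIGMA \<mu>:P. alternatives Z \<Theta> Mbar n \<Delta> \<mu>)" by auto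
    have "(\<lambda>(\<mu>, \<theta>). accept_prob Z (Mbar \<theta>) (lam n) \<alpha> \<epsilon> n \<mu>) (\<mu>, \<theta>) \<le> ?s \<Delta> n"
      unfolding sup_prob_def if_not_P[OF False]
      by (rule cSUP_upper[OF m]) (use le_1 in \<open>auto intro!: bdd_aboveI2[of _ _ 1]\<close>)
    then show ?thesis
      by (rule order_trans[rotated]) (simp add: accept_prob_def)
  qed (simp add: sup_prob_def)
  have lower: "0 \<le> limsup (\<lambda>n. ereal (?s \<Delta> n))" for \<Delta>
    using Limsup_mono[of "\<lambda>_. 0" "\<lambda>n. ereal (?s \<Delta> n)" sequentially] nonneg
    by (simp add: Limsup_const)
  have upper: "limsup (\<lambda>n. ereal (?s \<Delta> n)) \<le> ereal (4 * ?d2 / (\<Delta> - C)\<^sup>2)" if "\<Delta> > C" for \<Delta>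
  proof (rule Limsup_bounded)
    show "\<forall>\<^sub>F n in sequentially. ereal (?s \<Delta> n) \<le> ereal (4 * ?d2 / (\<Delta> - C)\<^sup>2)"
      using eventually_gt_at_top[of 0]
    proof eventually_elim
      case (elim n)
      have "accept_prob Z (Mbar \<theta>) (lam n) \<alpha> \<epsilon> n \<mu> \<le> 4 * ?d2 / (\<Delta> - C)\<^sup>2"
        if "\<mu> \<in> P" "\<theta> \<in> alternatives Z \<Theta> Mbar n \<Delta> \<mu>" for \<mu> \<theta>
        using finite_model.accept_prob_power[OF model _ elim lam_pos[OF elim] \<alpha>, of \<theta> \<mu> \<Delta> \<epsilon>] that P \<open>\<Delta> > C\<close>
        by (auto simp: alternatives_def C_def algebra_simps)
      then show ?case by (auto simp: sup_prob_def intro!: cSUP_least)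
    qed
  qed
  show "Limsup at_top (\<lambda>\<Delta>. limsup (\<lambda>n. ereal (?s \<Delta> n))) = 0"
  proof (rule antisym)
    have "((\<lambda>\<Delta>. 4 * ?d2 / (\<Delta> - C)\<^sup>2) \<longlongrightarrow> 0) at_top"
      by real_asymp
    then have "Limsup at_top (\<lambda>\<Delta>. ereal (4 * ?d2 / (\<Delta> - C)\<^sup>2)) = 0"
      by (intro lim_imp_Limsup) (auto simp: zero_ereal_def)
    moreover have "Limsup at_top (\<lambda>\<Delta>. limsup (\<lambda>n. ereal (?s \<Delta> n)))
        \<le> Limsup at_top (\<lambda>\<Delta>. ereal (4 * ?d2 / (\<Delta> - C)\<^sup>2))"
      using upper by (intro Limsup_mono eventually_mono[OF eventually_gt_at_top[of C]])
    ultimately show "Limsup at_top (\<lambda>\<Delta>. limsup (\<lambda>n. ereal (?s \<Delta> n))) \<le> 0" by simp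
    have "(0 :: ereal) = Limsup at_top (\<lambda>\<Delta>::real. 0)"
      by (simp add: Limsup_const)
    also have "\<dots> \<le> Limsup at_top (\<lambda>\<Delta>. limsup (\<lambda>n. ereal (?s \<Delta> n)))"
      by (intro Limsup_mono always_eventually allI lower)
    finally show "0 \<le> Limsup at_top (\<lambda>\<Delta>. limsup (\<lambda>n. ereal (?s \<Delta> n)))" .
  qed
qed

end
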